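(* Let $\Bbbk$ be an algebraically closed field, let $G$ be an algebraic group over $\Bbbk$ acting (algebraically) on an irreducible, normal affine algebraic $\Bbbk$-variety $V$, let $\Bbbk[V]$ be the ring of regular functions on $V$, and let $\Bbbk[V]^G$ be the ring of invariants. Let $A\subseteq \Bbbk[V]^G$ be a finitely generated $\Bbbk$-subalgebra and let $f_1,\ldots,f_r\in A$ be such that $A_{f_i}=(\Bbbk[V]^G)_{f_i}$ for each $i=1,\ldots,r$. Write $\mathcal{V}_V(f_1,\ldots,f_r)\subseteq V$ for the common zero set of $f_1,\ldots,f_r$ in $V$. (1) If $\mathcal{V}_V(f_1,\ldots,f_r)\subseteq V$ has codimension at least $2$ (that is, if the ideal $(f_1,\ldots,f_r)\Bbbk[V]$ has height at least $2$ in $\Bbbk[V]$), then $\Bbbk[V]^G$ is equal to the ring of regular functions on the quasi-affine variety $\mathrm{Spec}(A)\setminus \mathcal{V}(f_1,\ldots,f_r)$, that is, $$\Bbbk[V]^G=\bigl(A:(f_1,\ldots,f_r)^\infty\bigr)_{Q(A)}.$$ (2) If $A$ is a separating algebra on $\mathcal{V}_V(f_1,\ldots,f_r)\subseteq V$, then $A$ is a separating algebra on all of $V$.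
   Context: The action of $G$ on $V$ induces an action on $\Bbbk[V]$ by $\sigma\cdot f=f\circ\sigma^{-1}$; the ring of invariants $\Bbbk[V]^G$ is the subalgebra of all $f\in\Bbbk[V]$ fixed by $G$. Since $V$ is irreducible and normal, $\Bbbk[V]$ is a normal, finitely generated $\Bbbk$-domain. For $u,v\in V$, an invariant $f\in\Bbbk[V]^G$ separates $u$ and $v$ if $f(u)\neq f(v)$. For a subset $U\subseteq V$, a subset $E\subseteq\Bbbk[V]^G$ is a separating set on $U$ if any two points of $U$ which are separated by some invariant in $\Bbbk[V]^G$ are separated by some element of $E$. A subalgebra $A\subseteq\Bbbk[V]^G$ which is a separating set on $U$ is called a separating algebra on $U$ (and simply a separating algebra when $U=V$). For a domain $R$, $Q(R)$ denotes its field of fractions, and $R_f$ is the localization of $R$ at the powers of $f$. For subsets $A,B$ of a commutative ring $S$, $$(A:B)_S:=\{f\in S\mid fB\subseteq A\},\qquad (A:B^\infty)_S:=\bigcup_{r\ge 1}(A:B^r)_S=\{f\in S\mid \exists r\geq 1 \text{ such that } fB^r\subseteq A\}.$$ Here $(f_1,\ldots,f_r)^\infty$ refers to the ideal of $A$ generated by $f_1,\ldots,f_r$ and its powers. For an irreducible affine variety $X$ with $R=\Bbbk[X]$ and $Y$ the zero set of an ideal $I$ of $R$, $(R:I^\infty)_{Q(R)}$ is the ring of regular functions on the quasi-affine variety $X\setminus Y$. *)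

theory Defs
  imports
    "HOL-Library.Extended_Nat"
    "HOL-Computational_Algebra.Polynomial"
    "HOL-Analysis.Function_Topology"
    "HOL-Algebra.Group_Action"
    "HOL-Algebra.Generated_Rings"
    "HOL-Algebra.Ideal_Product"
    "HOL-Algebra.Polynomials"
begin

section \<open>Fields of fractions, localization, colon ideals, height, normality\<close>

definition frac_class :: "('a, 'b) ring_scheme \<Rightarrow> 'a \<Rightarrow> 'a \<Rightarrow> ('a \<times> 'a) set" where
  "frac_class R a b = {(c, d). c \<in> carrier R \<and> d \<in> carrier R - {\<zero>\<^bsub>R\<^esub>} \<and> a \<otimes>\<^bsub>R\<^esub> d = c \<otimes>\<^bsub>R\<^esub> b}"

text \<open>The unions range over representatives; for a domain \<open>R\<close> all the sets united coincide.\<close>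

definition frac_field :: "('a, 'b) ring_scheme \<Rightarrow> ('a \<times> 'a) set ring" where
  "frac_field R =
    \<lparr> carrier = {frac_class R a b |a b. a \<in> carrier R \<and> b \<in> carrier R - {\<zero>\<^bsub>R\<^esub>}},
      mult = (\<lambda>M N. \<Union>p\<in>M. \<Union>q\<in>N. frac_class R (fst p \<otimes>\<^bsub>R\<^esub> fst q) (snd p \<otimes>\<^bsub>R\<^esub> snd q)),
      one = frac_class R \<one>\<^bsub>R\<^esub> \<one>\<^bsub>R\<^esub>,
      zero = frac_class R \<zero>\<^bsub>R\<^esub> \<one>\<^bsub>R\<^esub>,
      add = (\<lambda>M N. \<Union>p\<in>M. \<Union>q\<in>N.
               frac_class R (fst p \<otimes>\<^bsub>R\<^esub> snd q \<oplus>\<^bsub>R\<^esub> fst q \<otimes>\<^bsub>R\<^esub> snd p) (snd p \<otimes>\<^bsub>R\<^esub> snd q)) \<rparr>"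

definition frac_embed :: "('a, 'b) ring_scheme \<Rightarrow> 'a \<Rightarrow> ('a \<times> 'a) set" where
  "frac_embed R a = frac_class R a \<one>\<^bsub>R\<^esub>"

text \<open>In the following definitions \<open>L\<close> is a field and \<open>S\<close> a subring of it; localizations of \<open>S\<close> and
  its field of fractions are formed inside \<open>L\<close>.\<close>

definition fractions_of :: "('a, 'b) ring_scheme \<Rightarrow> 'a set \<Rightarrow> 'a set" where
  "fractions_of L S = {a \<otimes>\<^bsub>L\<^esub> inv\<^bsub>L\<^esub> b |a b. a \<in> S \<and> b \<in> S \<and> b \<noteq> \<zero>\<^bsub>L\<^esub>}"

text \<open>The localization at \<open>f = 0\<close> is the zero ring, rendered as the set \<open>{0}\<close>.\<close>

definition localize_at :: "('a, 'b) ring_scheme \<Rightarrow> 'a set \<Rightarrow> 'a \<Rightarrow> 'a set" where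
  "localize_at L S f =
    (if f = \<zero>\<^bsub>L\<^esub> then {\<zero>\<^bsub>L\<^esub>}
     else {a \<otimes>\<^bsub>L\<^esub> inv\<^bsub>L\<^esub> (f [^]\<^bsub>L\<^esub> (m::nat)) |a m. a \<in> S})"

definition colon :: "('a, 'b) ring_scheme \<Rightarrow> 'a set \<Rightarrow> 'a set \<Rightarrow> 'a set" where
  "colon S A B = {x \<in> carrier S. \<forall>b\<in>B. x \<otimes>\<^bsub>S\<^esub> b \<in> A}"

text \<open>\<open>(A : I\<^sup>\<infinity>)\<^sub>S\<close> for a subring \<open>A\<close> of \<open>S\<close> and an ideal \<open>I\<close> of \<open>A\<close>; the powers of \<open>I\<close> are the
  ideal powers in \<open>A\<close>.\<close>

definition colon_inf :: "'a ring \<Rightarrow> 'a set \<Rightarrow> 'a set \<Rightarrow> 'a set" where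
  "colon_inf S A I = (\<Union>r\<in>{1::nat..}. colon S A (I [^]\<^bsub>ideals_set (S\<lparr>carrier := A\<rparr>)\<^esub> r))"

text \<open>Regular functions on \<open>Spec(S)\<close> minus the zero set of \<open>I\<close>, for a subring \<open>S\<close> of the field \<open>L\<close>:
  the elements of the fraction field of \<open>S\<close> lying in the local ring at every point of that open
  set.\<close>

definition regular_on_complement :: "'a ring \<Rightarrow> 'a set \<Rightarrow> 'a set \<Rightarrow> 'a set" where
  "regular_on_complement L S I =
    {h \<in> fractions_of L S. \<forall>P. primeideal P (L\<lparr>carrier := S\<rparr>) \<and> \<not> I \<subseteq> P \<longrightarrow>
       (\<exists>a\<in>S. \<exists>b\<in>S - P. h = a \<otimes>\<^bsub>L\<^esub> inv\<^bsub>L\<^esub> b)}"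

definition prime_height :: "('a, 'b) ring_scheme \<Rightarrow> 'a set \<Rightarrow> enat" where
  "prime_height R P =
    Sup {enat m |m. \<exists>c :: nat \<Rightarrow> 'a set.
           (\<forall>i\<le>m. primeideal (c i) R) \<and> (\<forall>i<m. c i \<subset> c (Suc i)) \<and> c m = P}"

text \<open>The unit ideal has height \<open>\<infinity>\<close>; correspondingly the empty set has codimension \<open>\<infinity>\<close>.\<close>

definition ideal_height :: "('a, 'b) ring_scheme \<Rightarrow> 'a set \<Rightarrow> enat" where
  "ideal_height R I = Inf (prime_height R ` {P. primeideal P R \<and> I \<subseteq> P})"

definition integral_over :: "('a, 'b) ring_scheme \<Rightarrow> 'a set \<Rightarrow> 'a \<Rightarrow> bool" where
  "integral_over L S x \<longleftrightarrow>
    (\<exists>p. polynomial\<^bsub>L\<^esub> S p \<and> p \<noteq> [] \<and> hd p = \<one>\<^bsub>L\<^esub> \<and> ring.eval L p x = \<zero>\<^bsub>L\<^esub>)"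

definition normal_domain :: "('a, 'b) ring_scheme \<Rightarrow> bool" where
  "normal_domain R \<longleftrightarrow> domain R \<and>
    (\<forall>x\<in>carrier (frac_field R).
       integral_over (frac_field R) (frac_embed R ` carrier R) x \<longrightarrow> x \<in> frac_embed R ` carrier R)"

section \<open>Spaces with functions, varieties and algebraic groups\<close>

text \<open>A variety is a topological space with, for every open set \<open>U\<close>, a set of regular functions
  on \<open>U\<close> with values in the ground field. A function on \<open>U\<close> is represented by its extension that
  is \<open>undefined\<close> outside \<open>U\<close>.\<close>

record ('x, 'k) fun_space =
  topo :: "'x topology"
  reg :: "'x set \<Rightarrow> ('x \<Rightarrow> 'k) set"

definition space_with_functions :: "('x, 'k::field) fun_space \<Rightarrow> bool" where
  "space_with_functions M \<longleftrightarrow>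
    (\<forall>U. openin (topo M) U \<longrightarrow>
       reg M U \<subseteq> extensional U \<and>
       (\<forall>c. (\<lambda>x\<in>U. c) \<in> reg M U) \<and>
       (\<forall>f\<in>reg M U. \<forall>g\<in>reg M U.
          (\<lambda>x\<in>U. f x + g x) \<in> reg M U \<and> (\<lambda>x\<in>U. f x * g x) \<in> reg M U)) \<and>
    (\<forall>\<U>. (\<forall>U\<in>\<U>. openin (topo M) U) \<longrightarrow>
       (\<forall>f\<in>extensional (\<Union>\<U>).
          f \<in> reg M (\<Union>\<U>) \<longleftrightarrow> (\<forall>U\<in>\<U>. restrict f U \<in> reg M U))) \<and>
    (\<forall>U. openin (topo M) U \<longrightarrow> (\<forall>f\<in>reg M U.
       openin (topo M) {x \<in> U. f x \<noteq> 0} \<and>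
       (\<lambda>x\<in>{x \<in> U. f x \<noteq> 0}. inverse (f x)) \<in> reg M {x \<in> U. f x \<noteq> 0}))"

definition morphism ::
  "('x, 'k) fun_space \<Rightarrow> ('y, 'k) fun_space \<Rightarrow> ('x \<Rightarrow> 'y) \<Rightarrow> bool" where
  "morphism M N \<phi> \<longleftrightarrow> continuous_map (topo M) (topo N) \<phi> \<and>
    (\<forall>W. openin (topo N) W \<longrightarrow> (\<forall>f\<in>reg N W.
       (\<lambda>x\<in>{x \<in> topspace (topo M). \<phi> x \<in> W}. f (\<phi> x))
         \<in> reg M {x \<in> topspace (topo M). \<phi> x \<in> W}))"

definition isomorphic_spaces :: "('x, 'k) fun_space \<Rightarrow> ('y, 'k) fun_space \<Rightarrow> bool" where
  "isomorphic_spaces M N \<longleftrightarrow> (\<exists>\<phi> \<psi>. morphism M N \<phi> \<and> morphism N M \<psi> \<and>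
    (\<forall>x\<in>topspace (topo M). \<psi> (\<phi> x) = x) \<and> (\<forall>y\<in>topspace (topo N). \<phi> (\<psi> y) = y))"

definition open_subspace :: "('x, 'k) fun_space \<Rightarrow> 'x set \<Rightarrow> ('x, 'k) fun_space" where
  "open_subspace M U = M\<lparr>topo := subtopology (topo M) U\<rparr>"

text \<open>The categorical product of spaces with functions. Its topology is in general finer than the
  product topology: the sets on which a finite sum of products \<open>a(x) b(y)\<close> of regular functions
  does not vanish are a basis. Regular functions are locally quotients of such sums.\<close>

definition tensor_funs ::
  "('x, 'k::field) fun_space \<Rightarrow> ('y, 'k) fun_space \<Rightarrow> 'x set \<Rightarrow> 'y set \<Rightarrow> ('x \<times> 'y \<Rightarrow> 'k) set" where
  "tensor_funs M N U W =
    {\<lambda>(x, y). \<Sum>i<m. a i x * b i y |(m::nat) a b. (\<forall>i<m. a i \<in> reg M U \<and> b i \<in> reg N W)}"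

definition prod_space ::
  "('x, 'k::field) fun_space \<Rightarrow> ('y, 'k) fun_space \<Rightarrow> ('x \<times> 'y, 'k) fun_space" where
  "prod_space M N =
    \<lparr> topo = topology_generated_by {{z \<in> U \<times> W. t z \<noteq> 0} |U W t.
         openin (topo M) U \<and> openin (topo N) W \<and> t \<in> tensor_funs M N U W},
      reg = (\<lambda>D. {f \<in> extensional D. \<forall>z\<in>D. \<exists>U W s t.
         openin (topo M) U \<and> openin (topo N) W \<and>
         s \<in> tensor_funs M N U W \<and> t \<in> tensor_funs M N U W \<and>
         z \<in> U \<times> W \<and> t z \<noteq> 0 \<and>
         (\<forall>w\<in>U \<times> W. t w \<noteq> 0 \<longrightarrow> w \<in> D \<and> f w = s w / t w)}) \<rparr>"

text \<open>Points of affine \<open>n\<close>-space are functions on \<open>{..<n}\<close>, \<open>undefined\<close> elsewhere.\<close>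

definition affine_space :: "nat \<Rightarrow> (nat \<Rightarrow> 'k) set" where
  "affine_space n = {..<n} \<rightarrow>\<^sub>E UNIV"

inductive_set poly_funs :: "nat \<Rightarrow> ((nat \<Rightarrow> 'k::field) \<Rightarrow> 'k) set" for n :: nat where
  const: "(\<lambda>x. c) \<in> poly_funs n"
| coord: "i < n \<Longrightarrow> (\<lambda>x. x i) \<in> poly_funs n"
| add: "p \<in> poly_funs n \<Longrightarrow> q \<in> poly_funs n \<Longrightarrow> (\<lambda>x. p x + q x) \<in> poly_funs n"
| mult: "p \<in> poly_funs n \<Longrightarrow> q \<in> poly_funs n \<Longrightarrow> (\<lambda>x. p x * q x) \<in> poly_funs n"

definition zariski_closed :: "nat \<Rightarrow> (nat \<Rightarrow> 'k::field) set \<Rightarrow> bool" where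
  "zariski_closed n Z \<longleftrightarrow> (\<exists>S\<subseteq>poly_funs n. Z = {x \<in> affine_space n. \<forall>p\<in>S. p x = 0})"

definition affine_variety :: "nat \<Rightarrow> (nat \<Rightarrow> 'k::field) set \<Rightarrow> (nat \<Rightarrow> 'k, 'k) fun_space" where
  "affine_variety n Z =
    \<lparr> topo = topology_generated_by {{x \<in> Z. p x \<noteq> 0} |p. p \<in> poly_funs n},
      reg = (\<lambda>U. {f \<in> extensional U. \<forall>x\<in>U. \<exists>p\<in>poly_funs n. \<exists>q\<in>poly_funs n.
         q x \<noteq> 0 \<and> (\<forall>y\<in>Z. q y \<noteq> 0 \<longrightarrow> y \<in> U \<and> f y = p y / q y)}) \<rparr>"

definition variety :: "('x, 'k::field) fun_space \<Rightarrow> bool" where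
  "variety M \<longleftrightarrow> space_with_functions M \<and>
    (\<exists>\<U>. finite \<U> \<and> \<Union>\<U> = topspace (topo M) \<and>
       (\<forall>U\<in>\<U>. openin (topo M) U \<and>
          (\<exists>n Z. zariski_closed n Z \<and> isomorphic_spaces (open_subspace M U) (affine_variety n Z)))) \<and>
    closedin (topo (prod_space M M)) {(x, x) |x. x \<in> topspace (topo M)}"

definition irreducible_space :: "'x topology \<Rightarrow> bool" where
  "irreducible_space T \<longleftrightarrow> topspace T \<noteq> {} \<and>
    (\<forall>C D. closedin T C \<and> closedin T D \<and> topspace T = C \<union> D \<longrightarrow> topspace T = C \<or> topspace T = D)"

definition algebraic_group :: "('g, 'b) monoid_scheme \<Rightarrow> ('g, 'k::field) fun_space \<Rightarrow> bool" where
  "algebraic_group G M \<longleftrightarrow> group G \<and> variety M \<and> topspace (topo M) = carrier G \<and>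
    morphism (prod_space M M) M (\<lambda>(g, h). g \<otimes>\<^bsub>G\<^esub> h) \<and>
    morphism M M (\<lambda>g. inv\<^bsub>G\<^esub> g)"

definition algebraic_action ::
  "('g, 'b) monoid_scheme \<Rightarrow> ('g, 'k::field) fun_space \<Rightarrow> ('v, 'k) fun_space
    \<Rightarrow> ('g \<Rightarrow> 'v \<Rightarrow> 'v) \<Rightarrow> bool" where
  "algebraic_action G M N \<phi> \<longleftrightarrow> group_action G (topspace (topo N)) \<phi> \<and>
    morphism (prod_space M N) N (\<lambda>(g, v). \<phi> g v)"

section \<open>Coordinate rings, invariants and separation\<close>

definition coordinate_ring ::
  "nat \<Rightarrow> (nat \<Rightarrow> 'k::field) set \<Rightarrow> ((nat \<Rightarrow> 'k) \<Rightarrow> 'k) ring" where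
  "coordinate_ring n V =
    \<lparr> carrier = {restrict p V |p. p \<in> poly_funs n},
      mult = (\<lambda>f g. \<lambda>x\<in>V. f x * g x),
      one = (\<lambda>x\<in>V. 1),
      zero = (\<lambda>x\<in>V. 0),
      add = (\<lambda>f g. \<lambda>x\<in>V. f x + g x) \<rparr>"

definition constant_funs :: "'v set \<Rightarrow> ('v \<Rightarrow> 'k) set" where
  "constant_funs V = {\<lambda>x\<in>V. c |c. True}"

definition k_subalgebra :: "'v set \<Rightarrow> ('v \<Rightarrow> 'k) ring \<Rightarrow> ('v \<Rightarrow> 'k) set \<Rightarrow> bool" where
  "k_subalgebra V R A \<longleftrightarrow> subring A R \<and> constant_funs V \<subseteq> A"

definition finitely_generated_over_k :: "'v set \<Rightarrow> ('v \<Rightarrow> 'k) ring \<Rightarrow> ('v \<Rightarrow> 'k) set \<Rightarrow> bool" where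
  "finitely_generated_over_k V R A \<longleftrightarrow>
    (\<exists>S. finite S \<and> S \<subseteq> carrier R \<and> A = generate_ring R (constant_funs V \<union> S))"

definition invariant_ring ::
  "('g, 'b) monoid_scheme \<Rightarrow> ('g \<Rightarrow> 'v \<Rightarrow> 'v) \<Rightarrow> 'v set \<Rightarrow> ('v \<Rightarrow> 'k) ring \<Rightarrow> ('v \<Rightarrow> 'k) set" where
  "invariant_ring G \<phi> V R =
    {f \<in> carrier R. \<forall>g\<in>carrier G. (\<lambda>x\<in>V. f (\<phi> (inv\<^bsub>G\<^esub> g) x)) = f}"

definition zero_locus :: "'v set \<Rightarrow> ('v \<Rightarrow> 'k::zero) set \<Rightarrow> 'v set" where
  "zero_locus V F = {x \<in> V. \<forall>f\<in>F. f x = 0}"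

definition separates :: "('v \<Rightarrow> 'k) \<Rightarrow> 'v \<Rightarrow> 'v \<Rightarrow> bool" where
  "separates f u v \<longleftrightarrow> f u \<noteq> f v"

text \<open>\<open>B\<close> is the ring of invariants, \<open>E\<close> a subset of \<open>B\<close>.\<close>

definition separating_set :: "('v \<Rightarrow> 'k) set \<Rightarrow> ('v \<Rightarrow> 'k) set \<Rightarrow> 'v set \<Rightarrow> bool" where
  "separating_set B E U \<longleftrightarrow> E \<subseteq> B \<and>
    (\<forall>u\<in>U. \<forall>v\<in>U. (\<exists>f\<in>B. separates f u v) \<longrightarrow> (\<exists>f\<in>E. separates f u v))"

definition separating_algebra ::
  "'v set \<Rightarrow> ('v \<Rightarrow> 'k) ring \<Rightarrow> ('v \<Rightarrow> 'k) set \<Rightarrow> ('v \<Rightarrow> 'k) set \<Rightarrow> 'v set \<Rightarrow> bool" where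
  "separating_algebra V R B A U \<longleftrightarrow> k_subalgebra V R A \<and> separating_set B A U"

end

theory Submission
  imports Defs "HOL-Library.Function_Algebras"
begin

text \<open>Let \<open>S\<close> be the image of \<open>A\<close> in the field of fractions \<open>L\<close> of \<open>R = k[V]\<close>. Both the ring of regular
  functions on the complement of \<open>V(f\<^sub>1, \<dots>, f\<^sub>r)\<close> and the colon ring consist of the fractions \<open>x\<close> of
  \<open>S\<close> such that every \<open>f\<^sub>i\<close> has a power with \<open>x f\<^sub>i\<^sup>m \<in> S\<close>. An invariant has this property because
  \<open>A\<close> and the invariants have the same localizations at \<open>f\<^sub>i\<close>. Conversely, such an \<open>x\<close> lies in \<open>R\<close>:
  otherwise, \<open>R\<close> being Noetherian, some multiple \<open>z \<notin> R\<close> of \<open>x\<close> has a prime ideal of denominators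
  \<open>P = (R : z)\<close>, which contains all \<open>f\<^sub>i\<close> and hence properly contains a nonzero prime \<open>Q\<close>. Then \<open>z Q \<subseteq> Q\<close>
  or \<open>z P \<subseteq> P\<close>, so that \<open>z\<close> is integral over \<open>R\<close>, against normality. Finally a quotient \<open>h \<in> R\<close> of
  invariants \<open>a / b\<close> is fixed by the group on the dense open set where \<open>b \<noteq> 0\<close>, while the set of
  points where \<open>h\<close> and its translate differ is open; irreducibility makes it empty.

  For the second part, if \<open>h\<close> separates \<open>u\<close> and \<open>v\<close> and \<open>f\<^sub>i(u) = f\<^sub>i(v) \<noteq> 0\<close>, then \<open>h f\<^sub>i\<^sup>m \<in> A\<close>
  separates them too.\<close>

section \<open>Noetherian rings of polynomial functions\<close>

text \<open>For a subring \<open>S\<close> containing \<open>E\<close> this is the ideal of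
  \<open>S\<close> generated by \<open>E\<close>. It lives in a ring type, which functions form
  under pointwise operations, so that ring identities are left to the simplifier.\<close>

inductive_set lin_span :: "'a::comm_ring_1 set \<Rightarrow> 'a set \<Rightarrow> 'a set" for S E where
  zero: "0 \<in> lin_span S E"
| step: "c \<in> S \<Longrightarrow> x \<in> E \<Longrightarrow> y \<in> lin_span S E \<Longrightarrow> c * x + y \<in> lin_span S E"

locale sub_cring =
  fixes S :: "'a::comm_ring_1 set"
  assumes one_closed: "1 \<in> S" and minus_closed: "x \<in> S \<Longrightarrow> - x \<in> S"
    and add_closed: "x \<in> S \<Longrightarrow> y \<in> S \<Longrightarrow> x + y \<in> S"
    and mult_closed: "x \<in> S \<Longrightarrow> y \<in> S \<Longrightarrow> x * y \<in> S"
begin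

lemma zero_closed: "0 \<in> S"
  using add_closed[OF one_closed minus_closed[OF one_closed]] by simp

lemma power_closed: "x \<in> S \<Longrightarrow> x ^ n \<in> S"
  by (induction n) (auto intro: one_closed mult_closed)

lemma span_base: "x \<in> E \<Longrightarrow> x \<in> lin_span S E"
  using lin_span.step[OF one_closed, of x E 0] by (simp add: lin_span.zero)

lemma span_add: "x \<in> lin_span S E \<Longrightarrow> y \<in> lin_span S E \<Longrightarrow> x + y \<in> lin_span S E"
  by (induction rule: lin_span.induct) (auto simp: add.assoc intro: lin_span.step)

lemma span_scale: "x \<in> lin_span S E \<Longrightarrow> c \<in> S \<Longrightarrow> c * x \<in> lin_span S E"
proof (induction rule: lin_span.induct)
  case zero
  then show ?case by (simp add: lin_span.zero)
next
  case (step d x y)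
  then have "(c * d) * x + c * y \<in> lin_span S E"
    by (intro lin_span.step mult_closed)
  then show ?case by (simp add: algebra_simps)
qed

lemma span_diff: "x \<in> lin_span S E \<Longrightarrow> y \<in> lin_span S E \<Longrightarrow> x - y \<in> lin_span S E"
  using span_add[OF _ span_scale[OF _ minus_closed[OF one_closed]], of x E y] by simp

lemma span_subset:
  assumes "E \<subseteq> lin_span S Y" "x \<in> lin_span S E"
  shows "x \<in> lin_span S Y"
  using assms(2,1) by (induction rule: lin_span.induct) (auto intro: lin_span.zero span_add span_scale)

lemma span_mono: "E \<subseteq> Y \<Longrightarrow> lin_span S E \<subseteq> lin_span S Y"
  using span_subset span_base by blast

lemma span_closed:
  assumes "E \<subseteq> S" "x \<in> lin_span S E"
  shows "x \<in> S"
  using assms(2,1) by (induction rule: lin_span.induct) (auto intro: zero_closed add_closed mult_closed)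

end

text \<open>The ascending chain condition, stated for the ideals generated by the initial segments
  of a sequence.\<close>

definition noetherian_subring :: "'a::comm_ring_1 set \<Rightarrow> bool" where
  "noetherian_subring S \<longleftrightarrow> sub_cring S \<and>
    (\<forall>a :: nat \<Rightarrow> 'a. (\<forall>i. a i \<in> S) \<longrightarrow> (\<exists>n. a n \<in> lin_span S (a ` {..<n})))"

section \<open>Adjoining one element to a subring\<close>

text \<open>The degree bound \<open>d\<close> is strict.\<close>

fun poly_deg :: "'a::comm_ring_1 set \<Rightarrow> 'a \<Rightarrow> nat \<Rightarrow> 'a set" where
  "poly_deg S t 0 = {0}"
| "poly_deg S t (Suc d) = {y + s * t ^ d |y s. y \<in> poly_deg S t d \<and> s \<in> S}"

context sub_cring
begin

lemma poly_deg_SucI: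
  "y \<in> poly_deg S t d \<Longrightarrow> s \<in> S \<Longrightarrow> x = y + s * t ^ d \<Longrightarrow> x \<in> poly_deg S t (Suc d)"
  by auto

lemma poly_deg_zero: "0 \<in> poly_deg S t d"
  using zero_closed by (induction d) force+

lemma poly_deg_Suc: "poly_deg S t d \<subseteq> poly_deg S t (Suc d)"
  using zero_closed by force

lemma poly_deg_mono: "d \<le> e \<Longrightarrow> poly_deg S t d \<subseteq> poly_deg S t e"
  by (rule lift_Suc_mono_le[where f = "poly_deg S t", OF poly_deg_Suc])

lemma poly_deg_add: "x \<in> poly_deg S t d \<Longrightarrow> y \<in> poly_deg S t d \<Longrightarrow> x + y \<in> poly_deg S t d"
proof (induction d arbitrary: x y)
  case (Suc d)
  then obtain x' s y' s' where "x = x' + s * t ^ d" "y = y' + s' * t ^ d"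
    "x' \<in> poly_deg S t d" "y' \<in> poly_deg S t d" "s \<in> S" "s' \<in> S" by auto
  moreover from this have "x + y = (x' + y') + (s + s') * t ^ d"
    by (simp add: algebra_simps)
  ultimately show ?case using Suc.IH add_closed by (blast intro: poly_deg_SucI)
qed simp

lemma poly_deg_scale: "x \<in> poly_deg S t d \<Longrightarrow> c \<in> S \<Longrightarrow> c * x \<in> poly_deg S t d"
proof (induction d arbitrary: x)
  case (Suc d)
  then obtain x' s where "x = x' + s * t ^ d" "x' \<in> poly_deg S t d" "s \<in> S" by auto
  moreover from this have "c * x = c * x' + (c * s) * t ^ d"
    by (simp add: algebra_simps)
  ultimately show ?case using Suc.IH Suc.prems(2) mult_closed by (blast intro: poly_deg_SucI)
qed simp

lemma poly_deg_times_power: "x \<in> poly_deg S t d \<Longrightarrow> t ^ k * x \<in> poly_deg S t (d + k)"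
proof (induction d arbitrary: x)
  case 0
  then show ?case by (simp add: poly_deg_zero)
next
  case (Suc d)
  then obtain x' s where "x = x' + s * t ^ d" "x' \<in> poly_deg S t d" "s \<in> S" by auto
  moreover from this have "t ^ k * x = t ^ k * x' + s * t ^ (d + k)"
    by (simp add: algebra_simps power_add)
  ultimately show ?case using Suc.IH by (auto intro: poly_deg_SucI)
qed

lemma poly_deg_mult: "x \<in> poly_deg S t d \<Longrightarrow> y \<in> poly_deg S t e \<Longrightarrow> x * y \<in> poly_deg S t (e + d)"
proof (induction d arbitrary: x)
  case 0
  then show ?case by (simp add: poly_deg_zero)
next
  case (Suc d)
  then obtain x' s where x: "x = x' + s * t ^ d" "x' \<in> poly_deg S t d" "s \<in> S" by auto
  have "t ^ d * (s * y) \<in> poly_deg S t (e + Suc d)" "x' * y \<in> poly_deg S t (e + Suc d)"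
    using poly_deg_times_power[OF poly_deg_scale[OF Suc.prems(2) x(3)], of d]
      Suc.IH[OF x(2) Suc.prems(2)] poly_deg_mono[of "e + d" "e + Suc d" t] by auto
  from poly_deg_add[OF this] show ?case by (simp add: x algebra_simps)
qed

lemma adjoin_sub_cring: "sub_cring (\<Union>d. poly_deg S t d)"
proof
  show "1 \<in> (\<Union>d. poly_deg S t d)"
    using one_closed by (auto intro!: exI[of _ "Suc 0"])
  show "- x \<in> (\<Union>d. poly_deg S t d)" if "x \<in> (\<Union>d. poly_deg S t d)" for x
    using that poly_deg_scale[OF _ minus_closed[OF one_closed], of x t] by auto
  show "x + y \<in> (\<Union>d. poly_deg S t d)"
    if "x \<in> (\<Union>d. poly_deg S t d)" "y \<in> (\<Union>d. poly_deg S t d)" for x y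
  proof -
    from that obtain d e where "x \<in> poly_deg S t d" "y \<in> poly_deg S t e" by auto
    then have "x \<in> poly_deg S t (max d e)" "y \<in> poly_deg S t (max d e)"
      using poly_deg_mono[of d "max d e" t] poly_deg_mono[of e "max d e" t] by auto
    then show ?thesis using poly_deg_add by blast
  qed
  show "x * y \<in> (\<Union>d. poly_deg S t d)"
    if "x \<in> (\<Union>d. poly_deg S t d)" "y \<in> (\<Union>d. poly_deg S t d)" for x y
    using that poly_deg_mult by blast
qed

lemma subset_adjoin: "S \<subseteq> (\<Union>d. poly_deg S t d)"
  by (auto intro!: exI[of _ "Suc 0"])

lemma generator_in_adjoin: "t \<in> (\<Union>d. poly_deg S t d)"
proof -
  have "t \<in> poly_deg S t (Suc (Suc 0))"
    by (rule poly_deg_SucI[OF poly_deg_zero one_closed]) simp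
  then show ?thesis by blast
qed

end

section \<open>Hilbert's basis theorem\<close>

text \<open>Coefficients of a representation as a polynomial in \<open>t\<close> need not be unique; the proof picks
  elements of minimal degree outside the span of the previous ones and compares their
  leading coefficients.\<close>

theorem hilbert_basis:
  assumes "noetherian_subring S"
  shows "noetherian_subring (\<Union>d. poly_deg S t d)"
proof -
  interpret S: sub_cring S using assms unfolding noetherian_subring_def by blast
  define T where "T = (\<Union>d. poly_deg S t d)"
  interpret T: sub_cring T unfolding T_def by (rule S.adjoin_sub_cring)
  have ST: "S \<subseteq> T" and tT: "t \<in> T"
    unfolding T_def by (rule S.subset_adjoin, rule S.generator_in_adjoin)
  have "\<exists>n. a n \<in> lin_span T (a ` {..<n})" if aT: "\<And>i. a i \<in> T" for a :: "nat \<Rightarrow> 'a"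
  proof (rule ccontr)
    assume "\<not> ?thesis"
    then have a: "a n \<notin> lin_span T (a ` {..<n})" for n by blast
    \<comment> \<open>The ideal generated by the whole sequence, as an increasing union of
      stages.\<close>
    define I where "I = (\<Union>n. lin_span T (a ` {..<n}))"
    have mono: "m \<le> n \<Longrightarrow> lin_span T (a ` {..<m}) \<subseteq> lin_span T (a ` {..<n})" for m n
      by (rule T.span_mono) auto
    \<comment> \<open>Finitely many elements of \<open>I\<close> share one stage, so they never
      generate \<open>I\<close>: some later \<open>a m\<close> escapes them.\<close>
    have finite_stage: "\<exists>m. g ` {..<n} \<subseteq> lin_span T (a ` {..<m})"
      if "\<And>i. i < n \<Longrightarrow> g i \<in> I" for g and n :: nat
      using that
    proof (induction n)
      case (Suc n)
      then obtain m where m: "g ` {..<n} \<subseteq> lin_span T (a ` {..<m})" by auto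
      from Suc.prems[of n] obtain k where "g n \<in> lin_span T (a ` {..<k})"
        unfolding I_def by auto
      then have "g ` {..<Suc n} \<subseteq> lin_span T (a ` {..<max m k})"
        using m mono[of m "max m k"] mono[of k "max m k"] by (auto simp: lessThan_Suc)
      then show ?case by blast
    qed simp
    have aI: "a n \<in> I" for n
      unfolding I_def using T.span_base[of "a n" "a ` {..<Suc n}"] by blast
    have IT: "I \<subseteq> T"
      unfolding I_def using T.span_closed[of "a ` {..<n}" for n] aT by blast
    have span_I: "lin_span T (g ` {..<n}) \<subseteq> I" if gI: "\<And>i. i < n \<Longrightarrow> g i \<in> I" for g and n :: nat
    proof -
      obtain m where "g ` {..<n} \<subseteq> lin_span T (a ` {..<m})"
        using finite_stage[of n g, OF gI] by blast
      then have "lin_span T (g ` {..<n}) \<subseteq> lin_span T (a ` {..<m})"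
        using T.span_subset by blast
      then show ?thesis unfolding I_def by blast
    qed
    have I_diff: "x - y \<in> I" if "x \<in> I" "y \<in> I" for x y
    proof -
      from that obtain m k where "x \<in> lin_span T (a ` {..<m})" "y \<in> lin_span T (a ` {..<k})"
        unfolding I_def by auto
      then have "x - y \<in> lin_span T (a ` {..<max m k})"
        using mono[of m "max m k"] mono[of k "max m k"] by (intro T.span_diff) auto
      then show ?thesis unfolding I_def by blast
    qed
    define deg where "deg x = (LEAST d. x \<in> poly_deg S t d)" for x
    have deg: "x \<in> poly_deg S t (deg x)" if "x \<in> T" for x
      using that unfolding T_def deg_def by (auto intro: LeastI_ex)
    have deg_le: "deg x \<le> d" if "x \<in> poly_deg S t d" for x d
      using that unfolding deg_def by (rule Least_le)
    have "\<exists>g :: nat \<Rightarrow> 'a. \<forall>n. g n \<in> I - lin_span T (g ` {..<n}) \<and>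
        (\<forall>x \<in> I - lin_span T (g ` {..<n}). deg (g n) \<le> deg x)"
    \<comment> \<open>The condition on \<open>g n\<close> involves all its predecessors, hence the
      choice along a well-order.\<close>
    proof (rule dependent_wellorder_choice[where P = "\<lambda>g n r. r \<in> I - lin_span T (g ` {..<n}) \<and>
        (\<forall>x \<in> I - lin_span T (g ` {..<n}). deg r \<le> deg x)"])
      fix r and f g :: "nat \<Rightarrow> 'a" and n
      assume "\<And>y. y < n \<Longrightarrow> f y = g y"
      then have "f ` {..<n} = g ` {..<n}" by auto
      then show "(r \<in> I - lin_span T (f ` {..<n}) \<and>
          (\<forall>x\<in>I - lin_span T (f ` {..<n}). deg r \<le> deg x)) =
        (r \<in> I - lin_span T (g ` {..<n}) \<and>
          (\<forall>x\<in>I - lin_span T (g ` {..<n}). deg r \<le> deg x))" by simp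
    next
      fix n and g :: "nat \<Rightarrow> 'a"
      assume "\<And>y. y < n \<Longrightarrow> g y \<in> I - lin_span T (g ` {..<y}) \<and>
        (\<forall>x\<in>I - lin_span T (g ` {..<y}). deg (g y) \<le> deg x)"
      then obtain m where "g ` {..<n} \<subseteq> lin_span T (a ` {..<m})"
        using finite_stage[of n g] by blast
      then have "a m \<in> I - lin_span T (g ` {..<n})"
        using a[of m] aI T.span_subset by blast
      then obtain r where "r \<in> I - lin_span T (g ` {..<n})"
        "\<forall>x. deg x < deg r \<longrightarrow> x \<notin> I - lin_span T (g ` {..<n})"
        using exists_least_iff[of "\<lambda>d. \<exists>x. x \<in> I - lin_span T (g ` {..<n}) \<and> deg x = d"]
        by blast
      then show "\<exists>r. r \<in> I - lin_span T (g ` {..<n}) \<and>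
          (\<forall>x\<in>I - lin_span T (g ` {..<n}). deg r \<le> deg x)"
        by (metis linorder_not_le)
    qed
    then obtain g :: "nat \<Rightarrow> 'a" where choice: "\<forall>n. g n \<in> I - lin_span T (g ` {..<n}) \<and>
        (\<forall>x \<in> I - lin_span T (g ` {..<n}). deg (g n) \<le> deg x)" ..
    have gI: "g n \<in> I" and g_new: "g n \<notin> lin_span T (g ` {..<n})" for n
      using choice[THEN spec, of n] by simp_all
    have g_min: "deg (g n) \<le> deg x" if "x \<in> I" "x \<notin> lin_span T (g ` {..<n})" for n x
      using choice[THEN spec, of n] that by simp
    \<comment> \<open>The spans grow with the index, so \<open>g n\<close> was already a candidate
      when \<open>g i\<close> was chosen.\<close>
    have deg_mono: "deg (g i) \<le> deg (g n)" if "i \<le> n" for i n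
    proof -
      have "lin_span T (g ` {..<i}) \<subseteq> lin_span T (g ` {..<n})"
        using that by (intro T.span_mono) auto
      then show ?thesis using g_min[of "g n" i] gI g_new[of n] by blast
    qed
    \<comment> \<open>Degree bound zero would make \<open>g n\<close> zero, which lies in every
      span. So there is a leading coefficient \<open>s\<close>.\<close>
    have "\<exists>y s e. g n = y + s * t ^ e \<and> y \<in> poly_deg S t e \<and> s \<in> S \<and> deg (g n) = Suc e" for n
    proof (cases "deg (g n)")
      case 0
      then have "g n = 0" using deg[of "g n"] gI IT by auto
      then show ?thesis using g_new[of n] lin_span.zero by metis
    next
      case (Suc e)
      then show ?thesis using deg[of "g n"] gI IT by auto
    qed
    then obtain y s e where g: "\<And>n. g n = y n + s n * t ^ e n"
      and y: "\<And>n. y n \<in> poly_deg S t (e n)" and s: "\<And>n. s n \<in> S"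
      and deg_g: "\<And>n. deg (g n) = Suc (e n)" by metis
    have e_mono: "i \<le> n \<Longrightarrow> e i \<le> e n" for i n
      using deg_mono[of i n] deg_g by simp
    \<comment> \<open>The hypothesis on \<open>S\<close> is applied to the leading
      coefficients.\<close>
    obtain n where "s n \<in> lin_span S (s ` {..<n})"
      using assms s unfolding noetherian_subring_def by blast
    \<comment> \<open>Multiplying \<open>g i\<close> by \<open>t\<close> to the power
      \<open>e n - e i\<close> shifts its leading coefficient to degree \<open>e n\<close>. Thus
      each combination \<open>u\<close> of the earlier leading coefficients is the coefficient in
      degree \<open>e n\<close> of some \<open>h\<close> in the span.\<close>
    moreover have "\<exists>h\<in>lin_span T (g ` {..<n}). \<exists>z\<in>poly_deg S t (e n). h = z + u * t ^ e n"
      if "u \<in> lin_span S (s ` {..<n})" for u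
      using that
    proof (induction rule: lin_span.induct)
      case zero
      then show ?case
        by (intro bexI[of _ 0]) (auto simp: S.poly_deg_zero lin_span.zero)
    next
      case (step c x u)
      then obtain i h z where i: "i < n" "x = s i" and h: "h \<in> lin_span T (g ` {..<n})"
        and z: "z \<in> poly_deg S t (e n)" "h = z + u * t ^ e n" by auto
      let ?k = "e n - e i"
      have k: "e i + ?k = e n" using e_mono[of i n] i by simp
      have "(c * t ^ ?k) * g i + h \<in> lin_span T (g ` {..<n})"
        using step.hyps ST tT i h by (intro lin_span.step T.mult_closed T.power_closed) auto
      moreover have "c * (t ^ ?k * y i) + z \<in> poly_deg S t (e n)"
        using S.poly_deg_times_power[OF y[of i], of ?k] k step.hyps(1) z(1)
        by (simp add: S.poly_deg_add S.poly_deg_scale)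
      moreover have "t ^ e n = t ^ e i * t ^ ?k"
        using k by (simp flip: power_add)
      then have "(c * t ^ ?k) * g i + h = (c * (t ^ ?k * y i) + z) + (c * x + u) * t ^ e n"
        using i z(2) g[of i] by (simp add: algebra_simps)
      ultimately show ?case by blast
    qed
    ultimately obtain h z where h: "h \<in> lin_span T (g ` {..<n})"
      and z: "z \<in> poly_deg S t (e n)" "h = z + s n * t ^ e n" by blast
    \<comment> \<open>Subtracting \<open>h\<close> removes the leading term, so the degree bound
      drops from \<open>Suc (e n)\<close> to \<open>e n\<close>, against the minimality of
      \<open>g n\<close>.\<close>
    have "g n - h = y n + (-1) * z" using g z by simp
    then have "deg (g n - h) \<le> e n"
      using deg_le S.poly_deg_add S.poly_deg_scale y z S.minus_closed S.one_closed by metis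
    moreover have "g n - h \<in> I" using I_diff gI span_I h by blast
    moreover have "g n - h \<notin> lin_span T (g ` {..<n})"
      using T.span_add[OF _ h, of "g n - h"] g_new[of n] by auto
    ultimately show False using g_min[of "g n - h" n] deg_g[of n] by simp
  qed
  then show ?thesis
    unfolding noetherian_subring_def T_def[symmetric] using T.sub_cring_axioms by blast
qed

text \<open>Induction on the number of variables: with none the functions are constants, and
  \<open>poly_funs (Suc n)\<close> arises from \<open>poly_funs n\<close> by adjoining the last
  coordinate. All these functions have the same domain, so the inclusion needs no change of
  variables.\<close>

theorem poly_funs_noetherian: "noetherian_subring (poly_funs n :: ((nat \<Rightarrow> 'k::field) \<Rightarrow> 'k) set)"
proof -
  have sub: "sub_cring (poly_funs n :: ((nat \<Rightarrow> 'k) \<Rightarrow> 'k) set)" for n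
  proof
    show "- p \<in> poly_funs n" if "p \<in> poly_funs n" for p :: "(nat \<Rightarrow> 'k) \<Rightarrow> 'k"
      using poly_funs.mult[OF poly_funs.const[of "-1"] that] by (simp add: fun_Compl_def)
  qed (auto simp: one_fun_def plus_fun_def times_fun_def intro: poly_funs.intros)
  show ?thesis
  proof (induction n)
    case 0
    have const: "\<exists>c. p = (\<lambda>x. c)" if "p \<in> poly_funs 0" for p :: "(nat \<Rightarrow> 'k) \<Rightarrow> 'k"
      using that by (induction rule: poly_funs.induct) auto
    have "\<exists>n. a n \<in> lin_span (poly_funs 0) (a ` {..<n})"
      if a: "\<And>i. a i \<in> poly_funs 0" for a :: "nat \<Rightarrow> (nat \<Rightarrow> 'k) \<Rightarrow> 'k"
    \<comment> \<open>A zero first member lies in the span of the empty set; a nonzero constant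
      generates every other one.\<close>
    proof (cases "a 0 = 0")
      case True
      then show ?thesis using lin_span.zero by metis
    next
      case False
      obtain c d where cd: "a 0 = (\<lambda>x. c)" "a 1 = (\<lambda>x. d)"
        using const[OF a[of 0]] const[OF a[of 1]] by blast
      with False have "c \<noteq> 0" by (auto simp: zero_fun_def)
      then have "a (Suc 0) = (\<lambda>x. d / c) * a 0 + 0"
        using cd by (simp add: times_fun_def zero_fun_def plus_fun_def)
      also have "\<dots> \<in> lin_span (poly_funs 0) (a ` {..<Suc 0})"
        by (intro lin_span.intros poly_funs.const) auto
      finally show ?thesis by blast
    qed
    then show ?case using sub unfolding noetherian_subring_def by blast
  next
    case (Suc n)
    define T where "T = (\<Union>d. poly_deg (poly_funs n) (\<lambda>x :: nat \<Rightarrow> 'k. x n) d)"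
    interpret S: sub_cring "poly_funs n :: ((nat \<Rightarrow> 'k) \<Rightarrow> 'k) set" by (rule sub)
    interpret T: sub_cring T unfolding T_def by (rule S.adjoin_sub_cring)
    interpret S': sub_cring "poly_funs (Suc n) :: ((nat \<Rightarrow> 'k) \<Rightarrow> 'k) set" by (rule sub)
    have "T \<subseteq> poly_funs (Suc n)"
    proof -
      have incl: "p \<in> poly_funs (Suc n)" if "p \<in> poly_funs n" for p :: "(nat \<Rightarrow> 'k) \<Rightarrow> 'k"
        using that by (induction rule: poly_funs.induct) (auto intro: poly_funs.intros)
      have "p \<in> poly_funs (Suc n)" if "p \<in> poly_deg (poly_funs n) (\<lambda>x. x n) d"
        for p :: "(nat \<Rightarrow> 'k) \<Rightarrow> 'k" and d
        using that
      proof (induction d arbitrary: p)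
        case 0
        then show ?case using S'.zero_closed by (simp only: poly_deg.simps singleton_iff)
      next
        case (Suc d)
        then obtain y s where ys: "p = y + s * (\<lambda>x. x n) ^ d"
          "y \<in> poly_deg (poly_funs n) (\<lambda>x. x n) d" "s \<in> poly_funs n" by auto
        have "(\<lambda>x. x n) \<in> poly_funs (Suc n)" by (rule poly_funs.coord) simp
        then show ?case
          unfolding ys(1)
          by (intro S'.add_closed S'.mult_closed S'.power_closed incl[OF ys(3)] Suc.IH[OF ys(2)])
      qed
      then show ?thesis unfolding T_def by blast
    qed
    moreover have "p \<in> T" if "p \<in> poly_funs (Suc n)" for p
      using that
    proof (induction rule: poly_funs.induct)
      case (const c)
      then show ?case using S.subset_adjoin poly_funs.const unfolding T_def by blast
    next
      case (coord i)
      then show ?case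
        using S.subset_adjoin S.generator_in_adjoin poly_funs.coord[of i n] unfolding T_def
        by (cases "i = n") (blast, simp add: less_Suc_eq subset_iff)
    next
      case (add p q)
      then show ?case using T.add_closed[of p q] by (simp add: plus_fun_def)
    next
      case (mult p q)
      then show ?case using T.mult_closed[of p q] by (simp add: times_fun_def)
    qed
    ultimately have "poly_funs (Suc n) = T" by blast
    then show ?case using hilbert_basis[OF Suc.IH] unfolding T_def by metis
  qed
qed

text \<open>The same chain condition, for rings given as records.\<close>

definition noetherian_seq :: "('a, 'b) ring_scheme \<Rightarrow> bool" where
  "noetherian_seq R \<longleftrightarrow> (\<forall>a :: nat \<Rightarrow> 'a. range a \<subseteq> carrier R \<longrightarrow> (\<exists>n. a n \<in> genideal R (a ` {..<n})))"

text \<open>Restriction to \<open>V\<close> respects sums and products, so a relation among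
  polynomials representing the \<open>a i\<close> restricts to a relation among the
  \<open>a i\<close>.\<close>

theorem coordinate_ring_noetherian:
  assumes "ring (coordinate_ring n V)"
  shows "noetherian_seq (coordinate_ring n V)"
  unfolding noetherian_seq_def
proof (intro allI impI)
  fix a :: "nat \<Rightarrow> (nat \<Rightarrow> 'a) \<Rightarrow> 'a"
  let ?R = "coordinate_ring n V"
  interpret ring ?R by fact
  assume a: "range a \<subseteq> carrier ?R"
  then have "\<forall>i. \<exists>p\<in>poly_funs n. a i = restrict p V"
    by (auto simp: coordinate_ring_def image_subset_iff)
  then obtain p where p: "\<And>i. p i \<in> poly_funs n" "\<And>i. a i = restrict (p i) V" by metis
  then obtain m where "p m \<in> lin_span (poly_funs n) (p ` {..<m})"
    using poly_funs_noetherian[of n] unfolding noetherian_subring_def by blast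
  moreover have "restrict q V \<in> genideal ?R (a ` {..<m})"
    if "q \<in> lin_span (poly_funs n) (p ` {..<m})" for q
    using that
  proof (induction rule: lin_span.induct)
    case zero
    interpret I: ideal "genideal ?R (a ` {..<m})" ?R
      using a by (intro genideal_ideal) auto
    have "restrict 0 V = \<zero>\<^bsub>?R\<^esub>" by (simp add: coordinate_ring_def zero_fun_def)
    then show ?case using I.zero_closed by (simp only:)
  next
    case (step c x y)
    interpret I: ideal "genideal ?R (a ` {..<m})" ?R
      using a by (intro genideal_ideal) auto
    from step obtain i where i: "i < m" "x = p i" by auto
    have "a i \<in> genideal ?R (a ` {..<m})"
      using genideal_self[of "a ` {..<m}"] a i by blast
    moreover have "restrict c V \<in> carrier ?R" using step by (auto simp: coordinate_ring_def)
    ultimately have "restrict c V \<otimes>\<^bsub>?R\<^esub> a i \<oplus>\<^bsub>?R\<^esub> restrict y V \<in> genideal ?R (a ` {..<m})"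
      using step.IH by (intro I.a_closed I.I_l_closed)
    moreover have "restrict c V \<otimes>\<^bsub>?R\<^esub> a i \<oplus>\<^bsub>?R\<^esub> restrict y V = restrict (c * x + y) V"
      by (auto simp: coordinate_ring_def p i)
    ultimately show ?case by (simp only:)
  qed
  ultimately show "\<exists>n. a n \<in> genideal ?R (a ` {..<n})" using p by metis
qed

section \<open>The field of fractions of a domain\<close>

context "domain"
begin

text \<open>Two fractions with equal cross products solve the same cross-multiplication equations,
  because \<open>b\<close> and \<open>d\<close> cancel in a domain.\<close>

lemma frac_class_eq_iff:
  assumes "a \<in> carrier R" "b \<in> carrier R - {\<zero>}" "c \<in> carrier R" "d \<in> carrier R - {\<zero>}"
  shows "frac_class R a b = frac_class R c d \<longleftrightarrow> a \<otimes> d = c \<otimes> b"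
proof
  assume "frac_class R a b = frac_class R c d"
  moreover have "(a, b) \<in> frac_class R a b" using assms by (simp add: frac_class_def)
  ultimately have "(a, b) \<in> frac_class R c d" by simp
  then show "a \<otimes> d = c \<otimes> b" by (simp add: frac_class_def)
next
  assume eq: "a \<otimes> d = c \<otimes> b"
  have "a \<otimes> y = x \<otimes> b \<longleftrightarrow> c \<otimes> y = x \<otimes> d" if "x \<in> carrier R" "y \<in> carrier R - {\<zero>}" for x y
  proof -
    have "a \<otimes> y = x \<otimes> b \<longleftrightarrow> (a \<otimes> y) \<otimes> d = (x \<otimes> b) \<otimes> d"
      using assms that by (subst m_rcancel) auto
    also have "(a \<otimes> y) \<otimes> d = (a \<otimes> d) \<otimes> y" using assms that by (simp add: m_ac)
    also have "\<dots> = (c \<otimes> y) \<otimes> b" using assms that by (simp add: eq m_ac)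
    also have "(x \<otimes> b) \<otimes> d = (x \<otimes> d) \<otimes> b" using assms that by (simp add: m_ac)
    also have "(c \<otimes> y) \<otimes> b = (x \<otimes> d) \<otimes> b \<longleftrightarrow> c \<otimes> y = x \<otimes> d"
      using assms that by (subst m_rcancel) auto
    finally show ?thesis .
  qed
  then show "frac_class R a b = frac_class R c d" unfolding frac_class_def by blast
qed

lemma frac_class_mem:
  assumes "a \<in> carrier R" "b \<in> carrier R - {\<zero>}" "p \<in> frac_class R a b"
  shows "fst p \<in> carrier R" "snd p \<in> carrier R - {\<zero>}" "frac_class R (fst p) (snd p) = frac_class R a b"
proof -
  show p: "fst p \<in> carrier R" "snd p \<in> carrier R - {\<zero>}"
    using assms(3) by (auto simp: frac_class_def)
  show "frac_class R (fst p) (snd p) = frac_class R a b"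
    using assms p by (subst frac_class_eq_iff) (auto simp: frac_class_def)
qed

lemma frac_class_self:
  "a \<in> carrier R \<Longrightarrow> b \<in> carrier R - {\<zero>} \<Longrightarrow> (a, b) \<in> frac_class R a b"
  by (simp add: frac_class_def)

lemma frac_field_carrierI:
  "a \<in> carrier R \<Longrightarrow> b \<in> carrier R - {\<zero>} \<Longrightarrow> frac_class R a b \<in> carrier (frac_field R)"
  by (auto simp: frac_field_def)

lemma frac_field_carrierE:
  assumes "x \<in> carrier (frac_field R)"
  obtains a b where "a \<in> carrier R" "b \<in> carrier R" "b \<noteq> \<zero>" "x = frac_class R a b"
  using assms by (auto simp: frac_field_def)

lemma nonzero_mult_closed:
  "a \<in> carrier R - {\<zero>} \<Longrightarrow> b \<in> carrier R - {\<zero>} \<Longrightarrow> a \<otimes> b \<in> carrier R - {\<zero>}"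
  using integral by auto

text \<open>The product unites over all representatives. Cross-multiplying shows that each choice
  contributes the same class, and neither factor is an empty class.\<close>

lemma frac_class_mult:
  assumes "a \<in> carrier R" "b \<in> carrier R - {\<zero>}" "c \<in> carrier R" "d \<in> carrier R - {\<zero>}"
  shows "frac_class R a b \<otimes>\<^bsub>frac_field R\<^esub> frac_class R c d = frac_class R (a \<otimes> c) (b \<otimes> d)"
proof -
  have "frac_class R (fst p \<otimes> fst q) (snd p \<otimes> snd q) = frac_class R (a \<otimes> c) (b \<otimes> d)"
    if p: "p \<in> frac_class R a b" and q: "q \<in> frac_class R c d" for p q
  proof -
    note P = frac_class_mem[OF assms(1,2) p] and Q = frac_class_mem[OF assms(3,4) q]
    have eq: "fst p \<otimes> b = a \<otimes> snd p" "fst q \<otimes> d = c \<otimes> snd q"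
      using P Q assms by (simp_all flip: frac_class_eq_iff)
    have "(fst p \<otimes> fst q) \<otimes> (b \<otimes> d) = (fst p \<otimes> b) \<otimes> (fst q \<otimes> d)"
      using P(1,2) Q(1,2) assms by (simp add: m_ac)
    also have "\<dots> = (a \<otimes> c) \<otimes> (snd p \<otimes> snd q)"
      unfolding eq using P(1,2) Q(1,2) assms by (simp add: m_ac)
    finally show ?thesis
      using P(1,2) Q(1,2) assms nonzero_mult_closed by (subst frac_class_eq_iff) auto
  qed
  then have "frac_class R a b \<otimes>\<^bsub>frac_field R\<^esub> frac_class R c d
      = (\<Union>p\<in>frac_class R a b. \<Union>q\<in>frac_class R c d. frac_class R (a \<otimes> c) (b \<otimes> d))"
    by (simp add: frac_field_def)
  then show ?thesis using frac_class_self[OF assms(1,2)] frac_class_self[OF assms(3,4)] by auto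
qed

lemma frac_class_add:
  assumes "a \<in> carrier R" "b \<in> carrier R - {\<zero>}" "c \<in> carrier R" "d \<in> carrier R - {\<zero>}"
  shows "frac_class R a b \<oplus>\<^bsub>frac_field R\<^esub> frac_class R c d = frac_class R (a \<otimes> d \<oplus> c \<otimes> b) (b \<otimes> d)"
proof -
  have "frac_class R (fst p \<otimes> snd q \<oplus> fst q \<otimes> snd p) (snd p \<otimes> snd q)
      = frac_class R (a \<otimes> d \<oplus> c \<otimes> b) (b \<otimes> d)"
    if p: "p \<in> frac_class R a b" and q: "q \<in> frac_class R c d" for p q
  proof -
    note P = frac_class_mem[OF assms(1,2) p] and Q = frac_class_mem[OF assms(3,4) q]
    have eq: "fst p \<otimes> b = a \<otimes> snd p" "fst q \<otimes> d = c \<otimes> snd q"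
      using P Q assms by (simp_all flip: frac_class_eq_iff)
    have "(fst p \<otimes> snd q \<oplus> fst q \<otimes> snd p) \<otimes> (b \<otimes> d)
        = (fst p \<otimes> b) \<otimes> (snd q \<otimes> d) \<oplus> (fst q \<otimes> d) \<otimes> (snd p \<otimes> b)"
      using P(1,2) Q(1,2) assms by (simp add: m_ac l_distr r_distr)
    also have "\<dots> = (a \<otimes> d \<oplus> c \<otimes> b) \<otimes> (snd p \<otimes> snd q)"
      unfolding eq using P(1,2) Q(1,2) assms by (simp add: m_ac l_distr r_distr)
    finally show ?thesis
      using P(1,2) Q(1,2) assms nonzero_mult_closed by (subst frac_class_eq_iff) auto
  qed
  then have "frac_class R a b \<oplus>\<^bsub>frac_field R\<^esub> frac_class R c d
      = (\<Union>p\<in>frac_class R a b. \<Union>q\<in>frac_class R c d. frac_class R (a \<otimes> d \<oplus> c \<otimes> b) (b \<otimes> d))"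
    by (simp add: frac_field_def)
  then show ?thesis using frac_class_self[OF assms(1,2)] frac_class_self[OF assms(3,4)] by auto
qed

lemma frac_field_zero: "\<zero>\<^bsub>frac_field R\<^esub> = frac_class R \<zero> \<one>"
  and frac_field_one: "\<one>\<^bsub>frac_field R\<^esub> = frac_class R \<one> \<one>"
  by (simp_all add: frac_field_def)

lemma frac_field_is_field: "field (frac_field R)"
proof -
  \<comment> \<open>These rules reduce the axioms to identities between expressions in
    \<open>R\<close>.\<close>
  note [simp] = frac_class_mult frac_class_add frac_field_zero frac_field_one integral_iff
    frac_class_eq_iff
  have cl: "b \<otimes> d \<in> carrier R - {\<zero>}"
    if "b \<in> carrier R" "b \<noteq> \<zero>" "d \<in> carrier R" "d \<noteq> \<zero>" for b d
    using that nonzero_mult_closed by blast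
  have group: "abelian_group (frac_field R)"
  proof (rule abelian_groupI)
    fix x y z
    assume xyz: "x \<in> carrier (frac_field R)" "y \<in> carrier (frac_field R)" "z \<in> carrier (frac_field R)"
    obtain a b where x: "a \<in> carrier R" "b \<in> carrier R" "b \<noteq> \<zero>" "x = frac_class R a b"
      using xyz(1) by (rule frac_field_carrierE)
    obtain c d where y: "c \<in> carrier R" "d \<in> carrier R" "d \<noteq> \<zero>" "y = frac_class R c d"
      using xyz(2) by (rule frac_field_carrierE)
    obtain e f where z: "e \<in> carrier R" "f \<in> carrier R" "f \<noteq> \<zero>" "z = frac_class R e f"
      using xyz(3) by (rule frac_field_carrierE)
    show "x \<oplus>\<^bsub>frac_field R\<^esub> y \<in> carrier (frac_field R)"
      using x y cl by (simp add: frac_field_carrierI)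
    show "x \<oplus>\<^bsub>frac_field R\<^esub> y = y \<oplus>\<^bsub>frac_field R\<^esub> x"
      using x y cl by (simp add: m_comm a_comm)
    show "(x \<oplus>\<^bsub>frac_field R\<^esub> y) \<oplus>\<^bsub>frac_field R\<^esub> z = x \<oplus>\<^bsub>frac_field R\<^esub> (y \<oplus>\<^bsub>frac_field R\<^esub> z)"
      using x y z cl by (simp add: m_ac a_ac l_distr r_distr)
  next
    fix x
    assume "x \<in> carrier (frac_field R)"
    then obtain a b where x: "a \<in> carrier R" "b \<in> carrier R" "b \<noteq> \<zero>" "x = frac_class R a b"
      by (rule frac_field_carrierE)
    show "\<zero>\<^bsub>frac_field R\<^esub> \<oplus>\<^bsub>frac_field R\<^esub> x = x"
      using x by simp
    have "frac_class R (\<ominus> a) b \<oplus>\<^bsub>frac_field R\<^esub> x = \<zero>\<^bsub>frac_field R\<^esub>"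
      using x by (simp add: l_minus l_neg)
    moreover have "frac_class R (\<ominus> a) b \<in> carrier (frac_field R)"
      using x by (simp add: frac_field_carrierI)
    ultimately show "\<exists>y\<in>carrier (frac_field R). y \<oplus>\<^bsub>frac_field R\<^esub> x = \<zero>\<^bsub>frac_field R\<^esub>" ..
  qed (simp add: frac_field_carrierI)
  have "cring (frac_field R)"
  proof (rule cringI[OF group comm_monoidI])
    fix x y z
    assume xyz: "x \<in> carrier (frac_field R)" "y \<in> carrier (frac_field R)" "z \<in> carrier (frac_field R)"
    obtain a b where x: "a \<in> carrier R" "b \<in> carrier R" "b \<noteq> \<zero>" "x = frac_class R a b"
      using xyz(1) by (rule frac_field_carrierE)
    obtain c d where y: "c \<in> carrier R" "d \<in> carrier R" "d \<noteq> \<zero>" "y = frac_class R c d"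
      using xyz(2) by (rule frac_field_carrierE)
    obtain e f where z: "e \<in> carrier R" "f \<in> carrier R" "f \<noteq> \<zero>" "z = frac_class R e f"
      using xyz(3) by (rule frac_field_carrierE)
    show "x \<otimes>\<^bsub>frac_field R\<^esub> y \<in> carrier (frac_field R)"
      using x y cl by (simp add: frac_field_carrierI)
    show "x \<otimes>\<^bsub>frac_field R\<^esub> y = y \<otimes>\<^bsub>frac_field R\<^esub> x"
      using x y cl by (simp add: m_comm)
    show "(x \<otimes>\<^bsub>frac_field R\<^esub> y) \<otimes>\<^bsub>frac_field R\<^esub> z = x \<otimes>\<^bsub>frac_field R\<^esub> (y \<otimes>\<^bsub>frac_field R\<^esub> z)"
      using x y z cl by (simp add: m_ac)
    show "(x \<oplus>\<^bsub>frac_field R\<^esub> y) \<otimes>\<^bsub>frac_field R\<^esub> z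
        = x \<otimes>\<^bsub>frac_field R\<^esub> z \<oplus>\<^bsub>frac_field R\<^esub> y \<otimes>\<^bsub>frac_field R\<^esub> z"
      using x y z cl by (simp add: m_ac l_distr r_distr)
  next
    show "\<one>\<^bsub>frac_field R\<^esub> \<otimes>\<^bsub>frac_field R\<^esub> x = x" if "x \<in> carrier (frac_field R)" for x
      using that by (elim frac_field_carrierE) simp
  qed (simp add: frac_field_carrierI)
  then interpret F: cring "frac_field R" .
  show ?thesis
  proof (rule F.cring_fieldI2)
    show "\<zero>\<^bsub>frac_field R\<^esub> \<noteq> \<one>\<^bsub>frac_field R\<^esub>" by simp
    fix x
    assume xc: "x \<in> carrier (frac_field R)" and nz: "x \<noteq> \<zero>\<^bsub>frac_field R\<^esub>"
    obtain a b where x: "a \<in> carrier R" "b \<in> carrier R" "b \<noteq> \<zero>" "x = frac_class R a b"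
      using xc by (rule frac_field_carrierE)
    with nz have "a \<noteq> \<zero>" by auto
    with x have "x \<otimes>\<^bsub>frac_field R\<^esub> frac_class R b a = \<one>\<^bsub>frac_field R\<^esub>"
      by (simp add: m_comm)
    moreover have "frac_class R b a \<in> carrier (frac_field R)"
      using x \<open>a \<noteq> \<zero>\<close> by (simp add: frac_field_carrierI)
    ultimately show "\<exists>y\<in>carrier (frac_field R). x \<otimes>\<^bsub>frac_field R\<^esub> y = \<one>\<^bsub>frac_field R\<^esub>" ..
  qed
qed

lemma frac_embed_hom: "frac_embed R \<in> ring_hom R (frac_field R)"
  by (rule ring_hom_memI)
    (simp_all add: frac_embed_def frac_field_carrierI frac_class_mult frac_class_add frac_field_one)

lemma frac_embed_inj: "inj_on (frac_embed R) (carrier R)"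
  by (rule inj_onI) (simp add: frac_embed_def frac_class_eq_iff)

end

section \<open>Extension of fractions over codimension two\<close>

lemma (in ring_hom_cring) image_subring:
  assumes "subring A R"
  shows "subring (h ` A) S"
proof (rule S.subringI)
  note a = subringE[OF assms]
  show "h ` A \<subseteq> carrier S" using a(1) by auto
  show "\<one>\<^bsub>S\<^esub> \<in> h ` A" using a(3) hom_one by (metis image_eqI)
  show "\<ominus>\<^bsub>S\<^esub> x \<in> h ` A" if "x \<in> h ` A" for x
    using that a(1,5) by (auto simp: subset_iff simp flip: hom_a_inv)
  show "x \<otimes>\<^bsub>S\<^esub> y \<in> h ` A" if "x \<in> h ` A" "y \<in> h ` A" for x y
    using that a(1,6) by (auto simp: subset_iff simp flip: hom_mult)
  show "x \<oplus>\<^bsub>S\<^esub> y \<in> h ` A" if "x \<in> h ` A" "y \<in> h ` A" for x y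
    using that a(1,7) by (auto simp: subset_iff simp flip: hom_add)
qed

text \<open>Some chain of primes ending in \<open>P\<close> has at least two steps. The prime
  directly below \<open>P\<close> properly contains yet another one, and therefore a nonzero
  element.\<close>

lemma (in "domain") ideal_height_ge_2:
  assumes "ideal_height R I \<ge> 2" "primeideal P R" "I \<subseteq> P"
  obtains Q q where "primeideal Q R" "Q \<subset> P" "q \<in> Q" "q \<noteq> \<zero>"
proof -
  have "2 \<le> prime_height R P"
    using assms unfolding ideal_height_def by (auto simp: le_Inf_iff)
  moreover have "enat 1 < 2" by (simp add: numeral_eq_enat)
  ultimately have "enat 1 < prime_height R P" by (rule less_le_trans[rotated])
  then obtain m c where m: "enat 1 < enat m"
    and c: "\<And>i. i \<le> m \<Longrightarrow> primeideal (c i) R" "\<And>i. i < m \<Longrightarrow> c i \<subset> c (Suc i)" "c m = P"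
    unfolding prime_height_def less_Sup_iff by blast
  \<comment> \<open>Indices are counted from the top: \<open>c (Suc k)\<close> is the prime just
    below \<open>P\<close>.\<close>
  define k where "k = m - 2"
  have k: "m = Suc (Suc k)" using m unfolding k_def by simp
  interpret c: primeideal "c k" R using c(1)[of k] k by simp
  have "c k \<subset> c (Suc k)" using c(2)[of k] k by simp
  then obtain q where "q \<in> c (Suc k)" "q \<notin> c k" by blast
  moreover from this have "q \<noteq> \<zero>" using c.zero_closed by blast
  moreover have "primeideal (c (Suc k)) R" "c (Suc k) \<subset> P"
    using c(1)[of "Suc k"] c(2)[of "Suc k"] c(3) k by simp_all
  ultimately show thesis using that by blast
qed

lemma (in primeideal) prime_of_power:
  assumes "x \<in> carrier R" "x [^] (n::nat) \<in> I"
  shows "x \<in> I"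
  using assms(2)
proof (induction n)
  case 0
  then show ?case using I_notcarr one_imp_carrier by simp
next
  case (Suc n)
  then show ?case using I_prime[of "x [^] n" x] assms(1) by auto
qed

section \<open>Integrality through spans of powers\<close>

context ring
begin

definition evals :: "'a set \<Rightarrow> 'a \<Rightarrow> nat \<Rightarrow> 'a set" where
  "evals S z n = {eval p z |p. set p \<subseteq> S \<and> length p = n}"

lemma evals_0: "evals S z 0 = {\<zero>}"
  by (auto simp: evals_def)

lemma evals_SucI: "c \<in> S \<Longrightarrow> y \<in> evals S z n \<Longrightarrow> c \<otimes> z [^] n \<oplus> y \<in> evals S z (Suc n)"
proof -
  assume "c \<in> S" "y \<in> evals S z n"
  then obtain p where "set (c # p) \<subseteq> S" "length (c # p) = Suc n" "y = eval p z" "length p = n"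
    unfolding evals_def by auto
  then show "c \<otimes> z [^] n \<oplus> y \<in> evals S z (Suc n)"
    unfolding evals_def by (intro CollectI exI[of _ "c # p"]) simp
qed

lemma evals_SucE:
  assumes "x \<in> evals S z (Suc n)"
  obtains c y where "c \<in> S" "y \<in> evals S z n" "x = c \<otimes> z [^] n \<oplus> y"
proof -
  from assms obtain p where "set p \<subseteq> S" "length p = Suc n" "x = eval p z"
    by (auto simp: evals_def)
  then show thesis by (cases p) (auto intro!: that simp: evals_def)
qed

context
  fixes S z
  assumes S: "subring S R" and z: "z \<in> carrier R"
begin

lemma evals_carrier: "x \<in> evals S z n \<Longrightarrow> x \<in> carrier R"
proof (induction n arbitrary: x)
  case (Suc n)
  then show ?case using subringE(1)[OF S] z by (elim evals_SucE) auto
qed (simp add: evals_0)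

lemma evals_zero: "\<zero> \<in> evals S z n"
proof (induction n)
  case (Suc n)
  from evals_SucI[OF subringE(2)[OF S] this] show ?case using z by simp
qed (simp add: evals_0)

lemma evals_mono: "m \<le> n \<Longrightarrow> evals S z m \<subseteq> evals S z n"
proof (rule lift_Suc_mono_le[where f = "evals S z"], rule subsetI)
  fix n x assume "x \<in> evals S z n"
  with evals_SucI[OF subringE(2)[OF S] this] show "x \<in> evals S z (Suc n)"
    using z evals_carrier by simp
qed

lemma evals_power: "i < n \<Longrightarrow> z [^] i \<in> evals S z n"
  using evals_SucI[OF subringE(3)[OF S] evals_zero[of i]] evals_mono[of "Suc i" n] z by auto

lemma evals_add: "x \<in> evals S z n \<Longrightarrow> y \<in> evals S z n \<Longrightarrow> x \<oplus> y \<in> evals S z n"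
proof (induction n arbitrary: x y)
  case (Suc n)
  obtain c u where x: "c \<in> S" "u \<in> evals S z n" "x = c \<otimes> z [^] n \<oplus> u"
    using Suc.prems(1) by (rule evals_SucE)
  obtain d v where y: "d \<in> S" "v \<in> evals S z n" "y = d \<otimes> z [^] n \<oplus> v"
    using Suc.prems(2) by (rule evals_SucE)
  have [simp]: "c \<in> carrier R" "d \<in> carrier R" "u \<in> carrier R" "v \<in> carrier R"
    using x y subringE(1)[OF S] evals_carrier by auto
  have "(c \<oplus> d) \<otimes> z [^] n \<oplus> (u \<oplus> v) \<in> evals S z (Suc n)"
    using x y Suc.IH subringE(7)[OF S] by (intro evals_SucI) auto
  also have "(c \<oplus> d) \<otimes> z [^] n \<oplus> (u \<oplus> v) = x \<oplus> y"
    using z by (simp add: x y l_distr a_ac)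
  finally show ?case .
qed (simp add: evals_0)

lemma evals_scale: "x \<in> evals S z n \<Longrightarrow> c \<in> S \<Longrightarrow> c \<otimes> x \<in> evals S z n"
proof (induction n arbitrary: x)
  case 0
  then show ?case using subringE(1)[OF S] by (auto simp: evals_0)
next
  case (Suc n)
  obtain d u where x: "d \<in> S" "u \<in> evals S z n" "x = d \<otimes> z [^] n \<oplus> u"
    using Suc.prems(1) by (rule evals_SucE)
  have [simp]: "c \<in> carrier R" "d \<in> carrier R" "u \<in> carrier R"
    using x Suc.prems subringE(1)[OF S] evals_carrier by auto
  have "(c \<otimes> d) \<otimes> z [^] n \<oplus> c \<otimes> u \<in> evals S z (Suc n)"
    using x Suc.IH Suc.prems subringE(6)[OF S] by (intro evals_SucI) auto
  also have "(c \<otimes> d) \<otimes> z [^] n \<oplus> c \<otimes> u = c \<otimes> x"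
    using z by (simp add: x r_distr m_assoc)
  finally show ?case .
qed

text \<open>Moving the lower powers to the other side leaves an equation with leading coefficient
  one. \<open>polynomial\<close> demands a nonzero leading coefficient, hence the assumption
  \<open>one_zero\<close>.\<close>

lemma integral_overI:
  assumes one_zero: "\<one> \<noteq> \<zero>" and pow: "z [^] n \<in> evals S z n"
  shows "integral_over R S z"
proof -
  have "\<ominus> \<one> \<otimes> z [^] n \<in> evals S z n"
    using pow by (intro evals_scale subringE(5)[OF S] subringE(3)[OF S])
  then obtain p where p: "set p \<subseteq> S" "length p = n" "eval p z = \<ominus> \<one> \<otimes> z [^] n"
    by (auto simp: evals_def)
  have "eval (\<one> # p) z = z [^] n \<oplus> \<ominus> \<one> \<otimes> z [^] n"
    using z p by simp
  also have "\<dots> = \<zero>" using z by (simp add: l_minus r_neg)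
  finally show ?thesis
    unfolding integral_over_def polynomial_def
    using p subringE(3)[OF S] one_zero by (intro exI[of _ "\<one> # p"]) auto
qed

end

end

section \<open>Ideals of denominators\<close>

locale embedded_domain = "domain" R + L: field L for R (structure) and L (structure) +
  fixes e
  assumes embed_hom: "e \<in> ring_hom R L" and embed_inj: "inj_on e (carrier R)"

sublocale embedded_domain \<subseteq> ring_hom_cring R L e
  by unfold_locales (rule embed_hom)

context embedded_domain
begin

text \<open>The ideal \<open>(R : z)\<close>, taken inside \<open>R\<close> and not inside its image
  in \<open>L\<close>, so that primes and heights of \<open>R\<close> apply to it directly.\<close>

definition denominators :: "'c \<Rightarrow> 'a set" where
  "denominators z = {d \<in> carrier R. z \<otimes>\<^bsub>L\<^esub> e d \<in> e ` carrier R}"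

lemma embed_eq_iff: "a \<in> carrier R \<Longrightarrow> b \<in> carrier R \<Longrightarrow> e a = e b \<longleftrightarrow> a = b"
  using embed_inj by (auto dest: inj_onD)

lemma embed_eq_zero_iff: "a \<in> carrier R \<Longrightarrow> e a = \<zero>\<^bsub>L\<^esub> \<longleftrightarrow> a = \<zero>"
  using embed_eq_iff[of a \<zero>] by simp

lemma embed_pow: "a \<in> carrier R \<Longrightarrow> e (a [^] (n::nat)) = e a [^]\<^bsub>L\<^esub> n"
  by (induction n) auto

lemma embed_image_subring: "subring (e ` carrier R) L"
  by (rule image_subring[OF carrier_is_subring])

lemma denominators_ideal:
  assumes z: "z \<in> carrier L"
  shows "ideal (denominators z) R"
proof (rule idealI)
  note S = subringE[OF embed_image_subring]
  show "ring R" by (rule ring_axioms)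
  show "subgroup (denominators z) (add_monoid R)"
  proof (rule add.subgroupI)
    have "\<zero> \<in> denominators z"
      using z S(2) by (simp add: denominators_def)
    then show "denominators z \<noteq> {}" by blast
    show "\<ominus> a \<in> denominators z" if "a \<in> denominators z" for a
      using that z S(5) unfolding denominators_def by (auto simp: L.r_minus)
    show "a \<oplus> b \<in> denominators z" if "a \<in> denominators z" "b \<in> denominators z" for a b
      using that z S(7) unfolding denominators_def by (auto simp: L.r_distr)
  qed (auto simp: denominators_def)
  show "x \<otimes> a \<in> denominators z" if "a \<in> denominators z" "x \<in> carrier R" for a x
  proof -
    have "z \<otimes>\<^bsub>L\<^esub> e (x \<otimes> a) = e x \<otimes>\<^bsub>L\<^esub> (z \<otimes>\<^bsub>L\<^esub> e a)"
      using that z by (simp add: denominators_def L.m_lcomm)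
    then show ?thesis using that S(6) unfolding denominators_def by auto
  qed
  then show "a \<otimes> x \<in> denominators z" if "a \<in> denominators z" "x \<in> carrier R" for a x
    using that m_comm[of a x] by (simp add: denominators_def)
qed

text \<open>By the chain condition one of the elements \<open>z^n q\<close> of \<open>R\<close> is a
  combination of those with smaller exponent; dividing by \<open>q\<close> expresses a power of
  \<open>z\<close> through lower ones.\<close>

lemma almost_integral_imp_integral:
  assumes noeth: "noetherian_seq R" and z: "z \<in> carrier L"
    and q: "q \<in> carrier R" "q \<noteq> \<zero>"
    and pow: "\<And>n::nat. z [^]\<^bsub>L\<^esub> n \<otimes>\<^bsub>L\<^esub> e q \<in> e ` carrier R"
  shows "integral_over L (e ` carrier R) z"
proof -
  note S = embed_image_subring
  have "\<forall>n. \<exists>a\<in>carrier R. e a = z [^]\<^bsub>L\<^esub> (n::nat) \<otimes>\<^bsub>L\<^esub> e q"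
    using pow by (metis imageE)
  then obtain a where a: "\<And>n. a n \<in> carrier R" "\<And>n. e (a n) = z [^]\<^bsub>L\<^esub> (n::nat) \<otimes>\<^bsub>L\<^esub> e q"
    by metis
  then obtain n where n: "a n \<in> Idl (a ` {..<n})"
    using noeth unfolding noetherian_seq_def by blast
  \<comment> \<open>The elements of \<open>R\<close> that are \<open>q\<close> times a combination
    of lower powers of \<open>z\<close>. They form an ideal containing \<open>a i\<close> for
    \<open>i < n\<close>, hence also \<open>a n\<close>.\<close>
  define J where "J = {y \<in> carrier R. \<exists>w\<in>L.evals (e ` carrier R) z n. e y = w \<otimes>\<^bsub>L\<^esub> e q}"
  have scale: "x \<otimes> y \<in> J" if "y \<in> J" "x \<in> carrier R" for x y
  proof -
    from that obtain w where w: "w \<in> L.evals (e ` carrier R) z n" "e y = w \<otimes>\<^bsub>L\<^esub> e q" "y \<in> carrier R"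
      unfolding J_def by blast
    have "e x \<otimes>\<^bsub>L\<^esub> w \<in> L.evals (e ` carrier R) z n"
      using L.evals_scale[OF S z w(1)] that by blast
    moreover have "e (x \<otimes> y) = (e x \<otimes>\<^bsub>L\<^esub> w) \<otimes>\<^bsub>L\<^esub> e q"
      using that w q L.evals_carrier[OF S z w(1)] by (simp add: L.m_assoc)
    ultimately show ?thesis using that w unfolding J_def by blast
  qed
  have "ideal J R"
  proof (rule idealI)
    show "ring R" by (rule ring_axioms)
    show "subgroup J (add_monoid R)"
    proof (rule add.subgroupI)
      have "\<zero> \<in> J"
        unfolding J_def using L.evals_zero[OF S z, of n] q by (auto intro!: bexI[of _ "\<zero>\<^bsub>L\<^esub>"])
      then show "J \<noteq> {}" by blast
      show "\<ominus> y \<in> J" if "y \<in> J" for y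
      proof -
        have "y \<in> carrier R" using that unfolding J_def by blast
        then show ?thesis using scale[OF that, of "\<ominus> \<one>"] by (simp add: l_minus)
      qed
      show "x \<oplus> y \<in> J" if xy: "x \<in> J" "y \<in> J" for x y
      proof -
        from xy obtain v w where
          v: "v \<in> L.evals (e ` carrier R) z n" "e x = v \<otimes>\<^bsub>L\<^esub> e q" "x \<in> carrier R" and
          w: "w \<in> L.evals (e ` carrier R) z n" "e y = w \<otimes>\<^bsub>L\<^esub> e q" "y \<in> carrier R"
          unfolding J_def by blast
        have "v \<oplus>\<^bsub>L\<^esub> w \<in> L.evals (e ` carrier R) z n"
          using L.evals_add[OF S z v(1) w(1)] .
        moreover have "e (x \<oplus> y) = (v \<oplus>\<^bsub>L\<^esub> w) \<otimes>\<^bsub>L\<^esub> e q"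
          using v w q L.evals_carrier[OF S z v(1)] L.evals_carrier[OF S z w(1)]
          by (simp add: L.l_distr)
        ultimately show ?thesis using v w unfolding J_def by blast
      qed
    qed (auto simp: J_def)
    show "x \<otimes> y \<in> J" if "y \<in> J" "x \<in> carrier R" for x y
      using scale that by blast
    then show "y \<otimes> x \<in> J" if "y \<in> J" "x \<in> carrier R" for x y
      using that m_comm[of y x] by (simp add: J_def)
  qed
  moreover have "a ` {..<n} \<subseteq> J"
    using a L.evals_power[OF S z] unfolding J_def by blast
  ultimately have "a n \<in> J" using n genideal_minimal by blast
  then obtain w where w: "w \<in> L.evals (e ` carrier R) z n" "e (a n) = w \<otimes>\<^bsub>L\<^esub> e q"
    unfolding J_def by blast
  have "z [^]\<^bsub>L\<^esub> n = w"
    using w a(2)[of n] q z L.evals_carrier[OF S z w(1)]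
    by (simp add: L.m_rcancel embed_eq_zero_iff)
  with w(1) show ?thesis using L.integral_overI[OF S z L.one_not_zero, of n] by simp
qed

text \<open>All \<open>z^n q\<close> stay in \<open>K\<close>, hence in \<open>R\<close>. So
  \<open>q\<close> is a common denominator of the powers of \<open>z\<close>, which makes
  \<open>z\<close> almost integral.\<close>

lemma integrally_closed_stable:
  assumes noeth: "noetherian_seq R"
    and normal: "\<And>z. z \<in> carrier L \<Longrightarrow> integral_over L (e ` carrier R) z \<Longrightarrow> z \<in> e ` carrier R"
    and z: "z \<in> carrier L" and K: "K \<subseteq> carrier R" and q: "q \<in> K" "q \<noteq> \<zero>"
    and stable: "\<And>x. x \<in> K \<Longrightarrow> z \<otimes>\<^bsub>L\<^esub> e x \<in> e ` K"
  shows "z \<in> e ` carrier R"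
proof (rule normal[OF z almost_integral_imp_integral[OF noeth z]])
  show "q \<in> carrier R" "q \<noteq> \<zero>" using q K by auto
  have "z [^]\<^bsub>L\<^esub> n \<otimes>\<^bsub>L\<^esub> e q \<in> e ` K" for n :: nat
  proof (induction n)
    case 0
    then show ?case using q K by auto
  next
    case (Suc n)
    then obtain x where x: "x \<in> K" "z [^]\<^bsub>L\<^esub> n \<otimes>\<^bsub>L\<^esub> e q = e x" by auto
    have "z [^]\<^bsub>L\<^esub> Suc n \<otimes>\<^bsub>L\<^esub> e q = z \<otimes>\<^bsub>L\<^esub> (z [^]\<^bsub>L\<^esub> n \<otimes>\<^bsub>L\<^esub> e q)"
      using z q K by (simp add: L.m_ac subset_iff)
    then show ?case using stable x by simp
  qed
  then show "z [^]\<^bsub>L\<^esub> n \<otimes>\<^bsub>L\<^esub> e q \<in> e ` carrier R" for n :: nat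
    using K by blast
qed

lemma denominators_unit_iff:
  "z \<in> carrier L \<Longrightarrow> \<one> \<in> denominators z \<longleftrightarrow> z \<in> e ` carrier R"
  by (simp add: denominators_def)

text \<open>A prime ideal of the form \<open>(R : z)\<close> has height at most 1 in a normal Noetherian domain.\<close>

lemma denominators_prime_height:
  assumes noeth: "noetherian_seq R"
    and normal: "\<And>z. z \<in> carrier L \<Longrightarrow> integral_over L (e ` carrier R) z \<Longrightarrow> z \<in> e ` carrier R"
    and z: "z \<in> carrier L" and P: "primeideal (denominators z) R"
    and Q: "primeideal Q R" "Q \<subset> denominators z" and q: "q \<in> Q" "q \<noteq> \<zero>"
  shows False
proof -
  interpret P: primeideal "denominators z" R by fact
  interpret Q: primeideal Q R by fact
  have "z \<notin> e ` carrier R"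
    using P.I_notcarr P.one_imp_carrier denominators_unit_iff[OF z] by blast
  moreover have "z \<in> e ` carrier R"
  \<comment> \<open>In either case multiplication by \<open>z\<close> carries a nonzero ideal into
    itself: \<open>(R : z)\<close> in the first, the smaller prime \<open>Q\<close> in the
    second.\<close>
  proof (cases "\<forall>p\<in>denominators z. z \<otimes>\<^bsub>L\<^esub> e p \<in> e ` denominators z")
    case True
    then show ?thesis
      using integrally_closed_stable[OF noeth normal z, of "denominators z" q] q Q(2) P.Icarr by blast
  next
    case False
    then obtain p where p: "p \<in> denominators z" "z \<otimes>\<^bsub>L\<^esub> e p \<notin> e ` denominators z" by blast
    then obtain u where u: "u \<in> carrier R" "z \<otimes>\<^bsub>L\<^esub> e p = e u" "u \<notin> denominators z"
      unfolding denominators_def by blast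
    \<comment> \<open>With \<open>v = z x\<close> and \<open>u = z p\<close>, both sides equal
      \<open>x z p\<close>.\<close>
    have swap: "v \<otimes> p = x \<otimes> u"
      if "v \<in> carrier R" "x \<in> carrier R" "z \<otimes>\<^bsub>L\<^esub> e x = e v" for v x
    proof -
      have "e (v \<otimes> p) = e x \<otimes>\<^bsub>L\<^esub> (z \<otimes>\<^bsub>L\<^esub> e p)"
        using that P.Icarr[OF p(1)] z by (simp add: L.m_ac flip: that(3))
      also have "\<dots> = e (x \<otimes> u)" using that u by simp
      finally show ?thesis
        using that u P.Icarr[OF p(1)] by (intro inj_onD[OF embed_inj]) auto
    qed
    \<comment> \<open>If \<open>p\<close> were in \<open>Q\<close>, then
      \<open>x u = (z x) p\<close> would be in \<open>Q\<close> for every \<open>x\<close> in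
      \<open>(R : z)\<close>. As \<open>u\<close> is not in \<open>Q\<close>, this would give
      \<open>(R : z) \<subseteq> Q\<close>.\<close>
    have pQ: "p \<notin> Q"
    proof
      assume pQ: "p \<in> Q"
      have "x \<in> Q" if x: "x \<in> denominators z" for x
      proof -
        obtain v where v: "v \<in> carrier R" "z \<otimes>\<^bsub>L\<^esub> e x = e v"
          using x unfolding denominators_def by blast
        have "x \<otimes> u \<in> Q"
          using swap[OF v(1) P.Icarr[OF x] v(2)] Q.I_l_closed[OF pQ v(1)] by simp
        then show ?thesis using Q.I_prime[OF P.Icarr[OF x] u(1)] u(3) Q(2) by blast
      qed
      then show False using Q(2) by blast
    qed
    \<comment> \<open>Now \<open>(z x) p = x u\<close> lies in \<open>Q\<close> while
      \<open>p\<close> does not, so primality puts \<open>z x\<close> into \<open>Q\<close>.\<close>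
    have "z \<otimes>\<^bsub>L\<^esub> e x \<in> e ` Q" if x: "x \<in> Q" for x
    proof -
      obtain v where v: "v \<in> carrier R" "z \<otimes>\<^bsub>L\<^esub> e x = e v"
        using x Q(2) unfolding denominators_def by blast
      have "v \<otimes> p \<in> Q"
        using swap[OF v(1) Q.Icarr[OF x] v(2)] Q.I_r_closed[OF x u(1)] by simp
      then show ?thesis
        using Q.I_prime[OF v(1) P.Icarr[OF p(1)]] pQ v(2) by auto
    qed
    then show ?thesis
      using integrally_closed_stable[OF noeth normal z, of Q q] q Q.Icarr by blast
  qed
  ultimately show False by blast
qed

lemma denominators_scale:
  assumes "z \<in> carrier L" "y \<in> carrier R" "d \<in> carrier R"
  shows "d \<in> denominators (z \<otimes>\<^bsub>L\<^esub> e y) \<longleftrightarrow> y \<otimes> d \<in> denominators z"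
  using assms by (simp add: denominators_def L.m_assoc)

text \<open>An ideal \<open>(R : z)\<close> with \<open>z\<close> outside \<open>R\<close> is prime
  if no multiple of \<open>z\<close> outside \<open>R\<close> has a larger one: when
  \<open>a b\<close> clears \<open>z\<close> and \<open>a\<close> does not, \<open>b\<close> clears
  \<open>z a\<close> and so lies in \<open>(R : z)\<close>. The chain condition supplies such a
  \<open>z\<close>.\<close>

lemma exists_prime_denominators:
  assumes noeth: "noetherian_seq R" and x: "x \<in> carrier L" "x \<notin> e ` carrier R"
  obtains z where "z \<in> carrier L" "primeideal (denominators z) R" "denominators x \<subseteq> denominators z"
proof -
  define good where "good z \<longleftrightarrow> z \<in> carrier L \<and> z \<notin> e ` carrier R \<and>
    denominators x \<subseteq> denominators z" for z
  have sub: "denominators z \<subseteq> denominators (z \<otimes>\<^bsub>L\<^esub> e y)" if "z \<in> carrier L" "y \<in> carrier R" for z y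
  proof
    fix d assume d: "d \<in> denominators z"
    interpret ideal "denominators z" R using denominators_ideal that(1) .
    show "d \<in> denominators (z \<otimes>\<^bsub>L\<^esub> e y)"
      using denominators_scale[OF that Icarr[OF d]] I_l_closed[OF d that(2)] by simp
  qed
  have "\<exists>z. good z \<and> (\<forall>y\<in>carrier R. z \<otimes>\<^bsub>L\<^esub> e y \<notin> e ` carrier R \<longrightarrow>
      denominators (z \<otimes>\<^bsub>L\<^esub> e y) \<subseteq> denominators z)"
  proof (rule ccontr)
    assume contr: "\<not> ?thesis"
    \<comment> \<open>Otherwise dependent choice builds a strictly increasing chain of ideals, and
      the new elements \<open>a n\<close> of its members form a sequence that violates
      \<open>noetherian_seq\<close>.\<close>
    have "\<exists>w. \<forall>n::nat. good (w n) \<and> denominators (w n) \<subset> denominators (w (Suc n))"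
    proof (rule dependent_nat_choice)
      show "\<exists>z. good z" using x unfolding good_def by blast
      fix z and n :: nat
      assume "good z"
      then obtain y where "y \<in> carrier R" "z \<otimes>\<^bsub>L\<^esub> e y \<notin> e ` carrier R"
        "\<not> denominators (z \<otimes>\<^bsub>L\<^esub> e y) \<subseteq> denominators z" using contr by blast
      with \<open>good z\<close> sub[of z y]
      show "\<exists>w. good w \<and> denominators z \<subset> denominators w"
        unfolding good_def by (intro exI[of _ "z \<otimes>\<^bsub>L\<^esub> e y"]) auto
    qed
    then obtain w where w: "\<And>n. good (w n)" "\<And>n. denominators (w n) \<subset> denominators (w (Suc n))"
      by blast
    then have "\<forall>n. \<exists>a. a \<in> denominators (w (Suc n)) - denominators (w n)" by blast
    then obtain a where a: "\<And>n. a n \<in> denominators (w (Suc n))" "\<And>n. a n \<notin> denominators (w n)"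
      by (metis DiffE)
    have "range a \<subseteq> carrier R" using a(1) unfolding denominators_def by blast
    then obtain n where n: "a n \<in> Idl (a ` {..<n})"
      using noeth unfolding noetherian_seq_def by blast
    have mono: "denominators (w i) \<subseteq> denominators (w j)" if "i \<le> j" for i j
      using lift_Suc_mono_le[of "\<lambda>n. denominators (w n)", OF _ that] w(2) by blast
    have "a ` {..<n} \<subseteq> denominators (w n)"
    proof (rule image_subsetI)
      fix i assume "i \<in> {..<n}"
      \<comment> \<open>The element \<open>a i\<close> enters with index \<open>Suc i\<close>, which
        is at most \<open>n\<close>.\<close>
      then show "a i \<in> denominators (w n)" using mono[of "Suc i" n] a(1)[of i] by auto
    qed
    then have "a n \<in> denominators (w n)"
      using n genideal_minimal[OF denominators_ideal] w(1)[of n] unfolding good_def by blast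
    then show False using a(2) by blast
  qed
  then obtain z where z: "z \<in> carrier L" "z \<notin> e ` carrier R" "denominators x \<subseteq> denominators z"
    and max: "\<And>y. y \<in> carrier R \<Longrightarrow> z \<otimes>\<^bsub>L\<^esub> e y \<notin> e ` carrier R \<Longrightarrow>
      denominators (z \<otimes>\<^bsub>L\<^esub> e y) \<subseteq> denominators z"
    unfolding good_def by blast
  have "primeideal (denominators z) R"
  proof (rule primeidealI[OF denominators_ideal[OF z(1)] is_cring])
    show "carrier R \<noteq> denominators z" using denominators_unit_iff[OF z(1)] z(2) one_closed by blast
    fix a b assume ab: "a \<in> carrier R" "b \<in> carrier R" "a \<otimes> b \<in> denominators z"
    show "a \<in> denominators z \<or> b \<in> denominators z"
      using max[OF ab(1)] denominators_scale[OF z(1) ab(1,2)] ab unfolding denominators_def[of z] by blast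
  qed
  with z that show thesis by blast
qed

text \<open>An algebraic Hartogs theorem. A prime \<open>(R : z)\<close> containing
  \<open>(R : x)\<close> contains a power of each \<open>f\<close> in \<open>F\<close>, hence
  \<open>F\<close> itself, and would have height at least two, which
  \<open>denominators_prime_height\<close> excludes.\<close>

theorem normal_noetherian_hartogs:
  assumes noeth: "noetherian_seq R"
    and normal: "\<And>z. z \<in> carrier L \<Longrightarrow> integral_over L (e ` carrier R) z \<Longrightarrow> z \<in> e ` carrier R"
    and F: "F \<subseteq> carrier R" "ideal_height R (Idl F) \<ge> 2"
    and x: "x \<in> carrier L" "\<And>f. f \<in> F \<Longrightarrow> \<exists>m::nat. x \<otimes>\<^bsub>L\<^esub> e f [^]\<^bsub>L\<^esub> m \<in> e ` carrier R"
  shows "x \<in> e ` carrier R"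
proof (rule ccontr)
  assume "x \<notin> e ` carrier R"
  then obtain z where z: "z \<in> carrier L" and P: "primeideal (denominators z) R"
    and sub: "denominators x \<subseteq> denominators z"
    using exists_prime_denominators[OF noeth x(1)] by blast
  interpret P: primeideal "denominators z" R by fact
  have "f \<in> denominators z" if f: "f \<in> F" for f
  proof -
    have fR: "f \<in> carrier R" using f F(1) by blast
    obtain m :: nat where "x \<otimes>\<^bsub>L\<^esub> e f [^]\<^bsub>L\<^esub> m \<in> e ` carrier R" using x(2)[OF f] by blast
    then have "f [^] m \<in> denominators x"
      unfolding denominators_def using embed_pow[OF fR, of m] nat_pow_closed[OF fR, of m]
      by (simp only: mem_Collect_eq simp_thms)
    then have "f [^] m \<in> denominators z" using sub by blast
    then show ?thesis by (rule P.prime_of_power[OF fR])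
  qed
  then have "Idl F \<subseteq> denominators z"
    by (intro genideal_minimal P.is_ideal subsetI)
  then obtain Q q where "primeideal Q R" "Q \<subset> denominators z" "q \<in> Q" "q \<noteq> \<zero>"
    using ideal_height_ge_2[OF F(2) P] by blast
  then show False using denominators_prime_height[OF noeth normal z P] by blast
qed

end

section \<open>Colon rings and regular functions\<close>

text \<open>An ideal maximal among those that contain \<open>D\<close> and miss all powers of
  \<open>f\<close> is prime. Zorn's lemma provides it, since unions of chains keep both
  conditions.\<close>

lemma (in cring) exists_prime_avoiding_powers:
  assumes D: "ideal D R" and f: "f \<in> carrier R" "\<And>m::nat. f [^] m \<notin> D"
  obtains P where "primeideal P R" "D \<subseteq> P" "f \<notin> P"
proof -
  define \<A> where "\<A> = {J. ideal J R \<and> D \<subseteq> J \<and> (\<forall>m::nat. f [^] m \<notin> J)}"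
  have "\<exists>P\<in>\<A>. \<forall>J\<in>\<A>. P \<subseteq> J \<longrightarrow> J = P"
  proof (rule subset_Zorn_nonempty)
    show "\<A> \<noteq> {}" using D f unfolding \<A>_def by blast
    fix C assume C: "C \<noteq> {}" "subset.chain \<A> C"
    then have ideals: "\<And>J. J \<in> C \<Longrightarrow> ideal J R" and CA: "C \<subseteq> \<A>"
      unfolding subset.chain_def \<A>_def by blast+
    have "ideal (\<Union>C) R"
    proof (rule idealI)
      show "ring R" by (rule ring_axioms)
      show "subgroup (\<Union>C) (add_monoid R)"
      proof (rule add.subgroupI)
        show "\<Union>C \<subseteq> carrier R" using ideals ideal.Icarr by fast
        obtain J where "J \<in> C" using C by blast
        then show "\<Union>C \<noteq> {}"
          using additive_subgroup.zero_closed[OF ideal.axioms(1)[OF ideals]] by blast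
        show "\<ominus> a \<in> \<Union>C" if "a \<in> \<Union>C" for a
          using that ideals additive_subgroup.a_inv_closed ideal.axioms(1) by (metis Union_iff)
        show "a \<oplus> b \<in> \<Union>C" if ab: "a \<in> \<Union>C" "b \<in> \<Union>C" for a b
        proof -
          obtain J K where JK: "J \<in> C" "K \<in> C" "a \<in> J" "b \<in> K" using ab by blast
          then have "J \<subseteq> K \<or> K \<subseteq> J" using C(2) unfolding subset.chain_def by blast
          then obtain H where "H \<in> C" "a \<in> H" "b \<in> H" using JK by blast
          then show ?thesis
            using additive_subgroup.a_closed[OF ideal.axioms(1)[OF ideals]] by blast
        qed
      qed
      show "x \<otimes> a \<in> \<Union>C" "a \<otimes> x \<in> \<Union>C" if "a \<in> \<Union>C" "x \<in> carrier R" for a x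
        using that ideal.I_l_closed[OF ideals] ideal.I_r_closed[OF ideals] by fast+
    qed
    then show "\<Union>C \<in> \<A>" using C CA unfolding \<A>_def by blast
  qed
  then obtain P where PA: "P \<in> \<A>" and max: "\<forall>J\<in>\<A>. P \<subseteq> J \<longrightarrow> J = P" ..
  have P: "ideal P R" "D \<subseteq> P" "f [^] m \<notin> P" for m :: nat
    using PA unfolding \<A>_def by auto
  interpret P: ideal P R by fact
  \<comment> \<open>By maximality, adding \<open>a\<close> to \<open>P\<close> must bring in a power
    of \<open>f\<close>.\<close>
  have power: "\<exists>m p s. f [^] (m::nat) = p \<oplus> s \<otimes> a \<and> p \<in> P \<and> s \<in> carrier R"
    if a: "a \<in> carrier R" "a \<notin> P" for a
  proof (rule ccontr)
    assume contr: "\<not> ?thesis"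
    define J where "J = P <+>\<^bsub>R\<^esub> PIdl a"
    have J: "ideal J R" unfolding J_def by (intro add_ideals cgenideal_ideal P(1) a(1))
    have mem: "x \<in> J \<longleftrightarrow> (\<exists>p\<in>P. \<exists>s\<in>carrier R. x = p \<oplus> s \<otimes> a)" for x
      unfolding J_def set_add_def' cgenideal_def by blast
    have "P \<subseteq> J"
    proof
      fix p assume "p \<in> P"
      then show "p \<in> J" using a unfolding mem by (intro bexI[of _ p] bexI[of _ \<zero>]) auto
    qed
    moreover have "J \<in> \<A>"
      unfolding \<A>_def using J P(2) \<open>P \<subseteq> J\<close> mem contr by blast
    ultimately have "J = P" using max by blast
    moreover have "a \<in> J"
      unfolding mem using a by (intro bexI[of _ \<zero>] bexI[of _ \<one>]) auto
    ultimately show False using a by blast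
  qed
  have "primeideal P R"
  proof (rule primeidealI[OF P(1) is_cring])
    show "carrier R \<noteq> P" using P(3)[of 0] by auto
    fix a b assume ab: "a \<in> carrier R" "b \<in> carrier R" "a \<otimes> b \<in> P"
    show "a \<in> P \<or> b \<in> P"
    proof (rule ccontr)
      assume "\<not> (a \<in> P \<or> b \<in> P)"
      then obtain m n :: nat and p q s t
        where m: "f [^] m = p \<oplus> s \<otimes> a" "p \<in> P" "s \<in> carrier R"
          and n: "f [^] n = q \<oplus> t \<otimes> b" "q \<in> P" "t \<in> carrier R"
        using power[OF ab(1)] power[OF ab(2)] by blast
      have [simp]: "p \<in> carrier R" "q \<in> carrier R" using m n P.Icarr by auto
      \<comment> \<open>The product of the two powers is again a power of \<open>f\<close>. It lies
        in \<open>P\<close> because every term has one of the factors \<open>p\<close>,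
        \<open>q\<close> and \<open>a b\<close>, all in \<open>P\<close>.\<close>
      have "f [^] (m + n) = (p \<oplus> s \<otimes> a) \<otimes> (q \<oplus> t \<otimes> b)"
        using f m n by (simp flip: nat_pow_mult)
      also have "\<dots> = (p \<otimes> (q \<oplus> t \<otimes> b) \<oplus> (s \<otimes> a) \<otimes> q) \<oplus> (s \<otimes> t) \<otimes> (a \<otimes> b)"
        using m n ab(1,2) by (simp add: l_distr r_distr m_ac a_ac)
      also have "\<dots> \<in> P"
      proof (intro P.a_closed)
        show "p \<otimes> (q \<oplus> t \<otimes> b) \<in> P" using m n ab by (intro P.I_r_closed) auto
        show "(s \<otimes> a) \<otimes> q \<in> P" using m n ab by (intro P.I_l_closed) auto
        show "(s \<otimes> t) \<otimes> (a \<otimes> b) \<in> P" using m n by (intro P.I_l_closed[OF ab(3)]) auto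
      qed
      finally show False using P(3) by blast
    qed
  qed
  moreover have "f \<notin> P" using P(3)[of 1] f(1) by simp
  ultimately show thesis using P(2) that by blast
qed

section \<open>Powers of ideals in a subring\<close>

lemma ideal_power_0: "I [^]\<^bsub>ideals_set R\<^esub> (0::nat) = carrier R"
  and ideal_power_Suc: "I [^]\<^bsub>ideals_set R\<^esub> Suc n = ideal_prod R (I [^]\<^bsub>ideals_set R\<^esub> n) I"
  by (simp_all add: nat_pow_def ideals_set_def)

lemma (in ring) ideal_power_ideal:
  "ideal I R \<Longrightarrow> ideal (I [^]\<^bsub>ideals_set R\<^esub> (n::nat)) R"
proof (induction n)
  case 0
  show ?case unfolding ideal_power_0 by (rule oneideal)
next
  case (Suc n)
  then show ?case unfolding ideal_power_Suc by (intro ideal_prod_is_ideal)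
qed

lemma (in ring) power_mem_ideal_power:
  assumes "ideal I R" "x \<in> I"
  shows "x [^] (n::nat) \<in> I [^]\<^bsub>ideals_set R\<^esub> n"
proof (induction n)
  case 0
  show ?case unfolding ideal_power_0 by simp
next
  case (Suc n)
  from ideal_prod.prod[OF this assms(2)] show ?case unfolding ideal_power_Suc by simp
qed

context cring
begin

context
  fixes S
  assumes S: "subring S R"
begin

lemma subring_power: "x [^]\<^bsub>R\<lparr>carrier := S\<rparr>\<^esub> (n::nat) = x [^] n"
  by (simp add: nat_pow_def)

lemma subring_power_closed: "x \<in> S \<Longrightarrow> x [^] (n::nat) \<in> S"
  using subringE(3)[OF S] subringE(6)[OF S] by (induction n) simp_all

lemma subring_cring: "cring (R\<lparr>carrier := S\<rparr>)"
  using subcring_iff[OF subringE(1)[OF S]] subcringI'[OF S] by simp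

text \<open>It serves twice: for a single fraction, whose denominators in \<open>S\<close> it
  collects, and for the multiples of an element by an ideal power.\<close>

lemma subring_colon_ideal:
  assumes T: "T \<subseteq> carrier R"
  shows "ideal {a \<in> S. \<forall>t\<in>T. t \<otimes> a \<in> S} (R\<lparr>carrier := S\<rparr>)" (is "ideal ?J ?S")
proof -
  interpret S: cring ?S by (rule subring_cring)
  note s = subringE[OF S]
  show ?thesis
  proof (rule idealI)
    show "ring ?S" by (rule S.ring_axioms)
    show "subgroup ?J (add_monoid ?S)"
    proof (rule S.add.subgroupI)
      show "?J \<noteq> {}" using s(2) T by (auto simp: subset_iff intro!: exI[of _ \<zero>])
      show "\<ominus>\<^bsub>?S\<^esub> a \<in> ?J" if "a \<in> ?J" for a
      proof -
        have "\<ominus>\<^bsub>?S\<^esub> a = \<ominus> a"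
          using that s(1,5) by (intro S.minus_equality) (auto simp: l_neg)
        then show ?thesis using that s(1,5) T by (auto simp: r_minus subset_iff)
      qed
      show "a \<oplus>\<^bsub>?S\<^esub> b \<in> ?J" if "a \<in> ?J" "b \<in> ?J" for a b
        using that s(1,7) T by (auto simp: r_distr subset_iff)
    qed auto
    show "x \<otimes>\<^bsub>?S\<^esub> a \<in> ?J" if "a \<in> ?J" "x \<in> carrier ?S" for a x
    proof -
      have "t \<otimes> (x \<otimes> a) = x \<otimes> (t \<otimes> a)" if "t \<in> T" for t
        using that \<open>a \<in> ?J\<close> \<open>x \<in> carrier ?S\<close> s(1) T by (auto simp: subset_iff m_lcomm)
      then show ?thesis using that s(6) by auto
    qed
    then show "a \<otimes>\<^bsub>?S\<^esub> x \<in> ?J" if "a \<in> ?J" "x \<in> carrier ?S" for a x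
      using that S.m_comm[of a x] by auto
  qed
qed

text \<open>The induction decreases the exponents \<open>m i\<close> one at a time: multiplying \<open>y\<close> by a generator
  \<open>f i\<close> lowers \<open>m i\<close>, and \<open>y\<close> lies in \<open>S\<close> as soon as one of the exponents vanishes.\<close>

lemma mult_ideal_power_closed:
  assumes fin: "finite K" and f: "f ` K \<subseteq> S"
    and I: "I = genideal (R\<lparr>carrier := S\<rparr>) (f ` K)"
    and y: "y \<in> carrier R" "\<And>i. i \<in> K \<Longrightarrow> y \<otimes> f i [^] (m i :: nat) \<in> S"
    and sum: "sum m K \<le> N"
    and b: "b \<in> I [^]\<^bsub>ideals_set (R\<lparr>carrier := S\<rparr>)\<^esub> Suc N"
  shows "y \<otimes> b \<in> S"
proof -
  let ?S = "R\<lparr>carrier := S\<rparr>"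
  interpret S: cring ?S by (rule subring_cring)
  note s = subringE[OF S]
  have I_ideal: "ideal I ?S" unfolding I using f by (intro S.genideal_ideal) simp
  have powers: "I [^]\<^bsub>ideals_set ?S\<^esub> (n::nat) \<subseteq> S" for n
    using ideal.Icarr[OF S.ideal_power_ideal[OF I_ideal, of n]] by auto
  \<comment> \<open>For fixed \<open>y\<close> the elements of \<open>S\<close> that multiply all of
    \<open>y I^n\<close> into \<open>S\<close> form an ideal. By \<open>gen\<close> it contains the
    generators, hence \<open>I\<close>; sums of products then give \<open>I^(n+1)\<close>.\<close>
  have step: "y \<otimes> b \<in> S"
    if y: "y \<in> carrier R"
      and gen: "\<And>i b. i \<in> K \<Longrightarrow> b \<in> I [^]\<^bsub>ideals_set ?S\<^esub> n \<Longrightarrow> (y \<otimes> f i) \<otimes> b \<in> S"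
      and b: "b \<in> I [^]\<^bsub>ideals_set ?S\<^esub> Suc n" for y b and n :: nat
  proof -
    let ?T = "(\<lambda>b. y \<otimes> b) ` (I [^]\<^bsub>ideals_set ?S\<^esub> n)"
    let ?J = "{a \<in> S. \<forall>t\<in>?T. t \<otimes> a \<in> S}"
    have "?T \<subseteq> carrier R" using y powers[of n] s(1) by auto
    then have "ideal ?J ?S" by (rule subring_colon_ideal)
    moreover have "f ` K \<subseteq> ?J"
    proof (rule image_subsetI)
      fix i assume i: "i \<in> K"
      have fi: "f i \<in> S" using f i by blast
      have "(y \<otimes> b) \<otimes> f i \<in> S" if b: "b \<in> I [^]\<^bsub>ideals_set ?S\<^esub> n" for b
      proof -
        have "b \<in> carrier R" "f i \<in> carrier R" using b fi powers[of n] s(1) by auto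
        then show ?thesis using gen[OF i b] y by (simp add: m_ac)
      qed
      with fi show "f i \<in> ?J" by blast
    qed
    ultimately have IJ: "I \<subseteq> ?J" unfolding I by (rule S.genideal_minimal)
    from b have "b \<in> ideal_prod ?S (I [^]\<^bsub>ideals_set ?S\<^esub> n) I" by (simp only: ideal_power_Suc)
    then have "b \<in> S \<and> y \<otimes> b \<in> S"
    proof (induction rule: ideal_prod.induct)
      case (prod b a)
      then have "b \<in> S" "a \<in> S" "(y \<otimes> b) \<otimes> a \<in> S" using IJ powers[of n] by auto
      then show ?case using y s(1,6) by (simp add: m_assoc subset_iff)
    next
      case (sum b1 b2)
      then show ?case using y s(1,7) by (simp add: r_distr subset_iff)
    qed
    then show ?thesis by blast
  qed
  show ?thesis
    using y sum b
  proof (induction N arbitrary: y m b)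
    case 0
    have "y \<otimes> f i \<otimes> b \<in> S"
      if i: "i \<in> K" and b: "b \<in> I [^]\<^bsub>ideals_set ?S\<^esub> (0::nat)" for i b
    proof -
      \<comment> \<open>A vanishing sum leaves only zeroth powers, so \<open>y\<close> itself is in
        \<open>S\<close>.\<close>
      have "m i = 0" using 0 i fin by auto
      then have "y \<in> S" using "0.prems"(2)[OF i] "0.prems"(1) by simp
      then show ?thesis using f i b powers[of 0] s(6) by blast
    qed
    then show ?case using step[of y 0 b] "0.prems"(1,4) by blast
  next
    case (Suc N)
    have "y \<otimes> f i \<otimes> b \<in> S"
      if i: "i \<in> K" and b: "b \<in> I [^]\<^bsub>ideals_set ?S\<^esub> Suc N" for i b
    proof -
      have fi: "f i \<in> S" "f i \<in> carrier R" using f i s(1) by auto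
      show ?thesis
      proof (cases "m i")
        case 0
        then have "y \<in> S" using Suc.prems(2)[OF i] Suc.prems(1) by simp
        then show ?thesis using fi b powers[of "Suc N"] s(6) by blast
      next
        case (Suc k)
        define m' where "m' = m(i := k)"
        have "sum m K = Suc (sum m' K)"
          using fin i Suc by (simp add: m'_def sum.remove)
        then have "sum m' K \<le> N" using Suc.prems(3) by simp
        moreover have "y \<otimes> f i \<in> carrier R" using Suc.prems(1) fi(2) by simp
        moreover have "(y \<otimes> f i) \<otimes> f j [^] m' j \<in> S" if j: "j \<in> K" for j
        proof (cases "j = i")
          case True
          have "(y \<otimes> f i) \<otimes> f i [^] k = y \<otimes> f i [^] Suc k"
            using Suc.prems(1) fi(2) nat_pow_Suc2[OF fi(2)] by (simp only: m_assoc nat_pow_closed)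
          then show ?thesis using Suc.prems(2)[OF i] Suc True by (simp add: m'_def)
        next
          case False
          have "f j \<in> carrier R" using f j s(1) by auto
          then have "(y \<otimes> f i) \<otimes> f j [^] m j = f i \<otimes> (y \<otimes> f j [^] m j)"
            using Suc.prems(1) fi(2) by (simp add: m_ac)
          then show ?thesis using Suc.prems(2)[OF j] fi(1) s(6) False by (simp add: m'_def)
        qed
        ultimately show ?thesis using Suc.IH[of "y \<otimes> f i" m' b] b by blast
      qed
    qed
    then show ?case using step[of y "Suc N" b] Suc.prems(1,4) by blast
  qed
qed

end

end

section \<open>Fractions and localizations inside a field\<close>

context field
begin

lemma eq_divide_iff:
  assumes "x \<in> carrier R" "a \<in> carrier R" "b \<in> carrier R" "b \<noteq> \<zero>"
  shows "x = a \<otimes> inv b \<longleftrightarrow> x \<otimes> b = a"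
proof -
  have b: "b \<in> Units R" using assms field_Units by blast
  then show ?thesis using assms by (auto simp: m_assoc)
qed

lemma fractions_of_closed:
  assumes "subring S R" "x \<in> fractions_of R S"
  shows "x \<in> carrier R"
proof -
  from assms(2) obtain a b where "x = a \<otimes> inv b" "a \<in> S" "b \<in> S" "b \<noteq> \<zero>"
    unfolding fractions_of_def by blast
  moreover from this have "inv b \<in> carrier R"
    using subringE(1)[OF assms(1)] field_Units by (intro Units_inv_closed) blast
  ultimately show ?thesis using subringE(1)[OF assms(1)] by blast
qed

end

lemma (in field) localize_at_eqD:
  assumes S: "subring S R" and T: "T \<subseteq> carrier R" and f: "f \<in> S"
    and eq: "localize_at R S f = localize_at R T f" and x: "x \<in> T"
  shows "\<exists>m::nat. x \<otimes> f [^] m \<in> S"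
\<comment> \<open>The localization at zero carries no information, but there \<open>x\<close> times
  the first power of \<open>f\<close> is zero, an element of \<open>S\<close>.\<close>
proof (cases "f = \<zero>")
  case True
  have "x \<in> carrier R" using x T by blast
  then have "x \<otimes> f [^] (1::nat) = \<zero>" using True by simp
  then show ?thesis using subringE(2)[OF S] by metis
next
  case False
  have xc: "x \<in> carrier R" and fc: "f \<in> carrier R" using x T f subringE(1)[OF S] by auto
  have "x = x \<otimes> inv (f [^] (0::nat))" using xc by simp
  then have "x \<in> localize_at R T f"
    unfolding localize_at_def if_not_P[OF False] using x by (intro CollectI exI conjI)
  then obtain a and m :: nat where a: "a \<in> S" "x = a \<otimes> inv (f [^] m)"
    unfolding eq[symmetric] unfolding localize_at_def if_not_P[OF False] by blast
  have "f [^] m \<noteq> \<zero>" using False fc by (induction m) (auto simp: integral_iff)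
  then have "x \<otimes> f [^] m = a"
    using a xc fc subringE(1)[OF S] eq_divide_iff[of x a "f [^] m"] by blast
  then show ?thesis using a(1) by blast
qed

locale generated_subring_ideal = field R for R :: "'a ring" (structure) +
  fixes S K f I
  assumes S: "subring S R" and fin: "finite K" and f: "f ` K \<subseteq> S"
    and I: "I = genideal (R\<lparr>carrier := S\<rparr>) (f ` K)"
begin

lemma generated_ideal: "ideal I (R\<lparr>carrier := S\<rparr>)" and generator_mem: "i \<in> K \<Longrightarrow> f i \<in> I"
proof -
  interpret S: cring "R\<lparr>carrier := S\<rparr>" by (rule subring_cring[OF S])
  show "ideal I (R\<lparr>carrier := S\<rparr>)" unfolding I using f by (intro S.genideal_ideal) simp
  show "i \<in> K \<Longrightarrow> f i \<in> I" unfolding I using f S.genideal_self[of "f ` K"] by auto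
qed

text \<open>If no power of \<open>f i\<close> clears \<open>x\<close>, some prime contains the
  denominators of \<open>x\<close> in \<open>S\<close> but not \<open>f i\<close>, and
  \<open>x\<close> is not in its local ring. Conversely a prime not containing \<open>I\<close>
  misses some \<open>f i\<close>, a power of which serves as denominator.\<close>

lemma regular_on_complement_eq:
  "regular_on_complement R S I
    = {x \<in> fractions_of R S. \<forall>i\<in>K. \<exists>m::nat. x \<otimes> f i [^] m \<in> S}"
proof -
  let ?S = "R\<lparr>carrier := S\<rparr>"
  interpret S: cring ?S by (rule subring_cring[OF S])
  note s = subringE[OF S]
  have "(\<forall>P. primeideal P ?S \<and> \<not> I \<subseteq> P \<longrightarrow> (\<exists>a\<in>S. \<exists>b\<in>S - P. x = a \<otimes> inv b))
      \<longleftrightarrow> (\<forall>i\<in>K. \<exists>m::nat. x \<otimes> f i [^] m \<in> S)" (is "?reg \<longleftrightarrow> ?pow")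
    if "x \<in> fractions_of R S" for x
  proof
    have x: "x \<in> carrier R" using fractions_of_closed[OF S that] .
    assume reg: ?reg
    show ?pow
    proof (intro ballI, rule ccontr)
      fix i assume i: "i \<in> K" and contr: "\<not> (\<exists>m::nat. x \<otimes> f i [^] m \<in> S)"
      let ?D = "{a \<in> S. \<forall>t\<in>{x}. t \<otimes> a \<in> S}"
      have D: "ideal ?D ?S" using x by (intro subring_colon_ideal[OF S]) simp
      have fi: "f i \<in> carrier ?S" using f i by auto
      have "f i [^]\<^bsub>?S\<^esub> m \<notin> ?D" for m :: nat
        using contr by (simp add: subring_power[OF S])
      then obtain P where P: "primeideal P ?S" "?D \<subseteq> P" "f i \<notin> P"
        using S.exists_prime_avoiding_powers[OF D fi] by blast
      interpret P: primeideal P ?S by fact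
      have "\<not> I \<subseteq> P" using P(3) generator_mem[OF i] by blast
      then obtain a b where ab: "a \<in> S" "b \<in> S" "b \<notin> P" "x = a \<otimes> inv b"
        using reg P(1) by blast
      have "b \<noteq> \<zero>" using ab(3) P.zero_closed by auto
      then have "x \<otimes> b = a" using ab s(1) x eq_divide_iff[of x a b] by blast
      then have "b \<in> ?D" using ab by simp
      then show False using P(2) ab(3) by blast
    qed
  next
    have x: "x \<in> carrier R" using fractions_of_closed[OF S that] .
    assume pow: ?pow
    show ?reg
    proof (intro allI impI, elim conjE)
      fix P assume P: "primeideal P ?S" "\<not> I \<subseteq> P"
      interpret P: primeideal P ?S by fact
      have "\<not> f ` K \<subseteq> P"
        using P(2) S.genideal_minimal[OF P.is_ideal] unfolding I by blast
      then obtain i where i: "i \<in> K" "f i \<notin> P" by blast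
      then obtain m :: nat where m: "x \<otimes> f i [^] m \<in> S" using pow by blast
      have b: "f i [^] m \<in> S" using f i(1) by (intro subring_power_closed[OF S]) blast
      have bP: "f i [^] m \<notin> P"
        using P.prime_of_power[of "f i" m] i f by (auto simp: subring_power[OF S])
      then have "f i [^] m \<noteq> \<zero>" using P.zero_closed by auto
      then have "x = (x \<otimes> f i [^] m) \<otimes> inv (f i [^] m)"
        using x b m s(1) eq_divide_iff[of x "x \<otimes> f i [^] m" "f i [^] m"] by blast
      then show "\<exists>a\<in>S. \<exists>b\<in>S - P. x = a \<otimes> inv b" using m b bP by blast
    qed
  qed
  then show ?thesis unfolding regular_on_complement_def by (intro Collect_cong conj_cong refl)
qed

text \<open>One inclusion holds because powers of the generators lie in the powers of
  \<open>I\<close>. The other is \<open>mult_ideal_power_closed\<close>, whose exponent exceeds the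
  sum of the given ones by one.\<close>

lemma colon_inf_eq:
  "colon_inf (R\<lparr>carrier := fractions_of R S\<rparr>) S I
    = {x \<in> fractions_of R S. \<forall>i\<in>K. \<exists>m::nat. x \<otimes> f i [^] m \<in> S}"
proof -
  let ?S = "R\<lparr>carrier := S\<rparr>"
  interpret S: cring ?S by (rule subring_cring[OF S])
  have colon: "x \<in> colon_inf (R\<lparr>carrier := fractions_of R S\<rparr>) S I \<longleftrightarrow>
    x \<in> fractions_of R S \<and> (\<exists>n\<ge>1::nat. \<forall>b\<in>I [^]\<^bsub>ideals_set ?S\<^esub> n. x \<otimes> b \<in> S)" for x
    unfolding colon_inf_def colon_def by auto
  have "(\<exists>n\<ge>1::nat. \<forall>b\<in>I [^]\<^bsub>ideals_set ?S\<^esub> n. x \<otimes> b \<in> S)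
      \<longleftrightarrow> (\<forall>i\<in>K. \<exists>m::nat. x \<otimes> f i [^] m \<in> S)" (is "?colon \<longleftrightarrow> ?pow")
    if "x \<in> fractions_of R S" for x
  proof
    assume ?colon
    then obtain n :: nat where n: "\<And>b. b \<in> I [^]\<^bsub>ideals_set ?S\<^esub> n \<Longrightarrow> x \<otimes> b \<in> S" by blast
    have "x \<otimes> f i [^] n \<in> S" if "i \<in> K" for i
      using n S.power_mem_ideal_power[OF generated_ideal generator_mem[OF that], of n]
      by (simp add: subring_power[OF S])
    then show ?pow by blast
  next
    assume ?pow
    then obtain m :: "_ \<Rightarrow> nat" where m: "\<And>i. i \<in> K \<Longrightarrow> x \<otimes> f i [^] m i \<in> S" by metis
    have "x \<otimes> b \<in> S" if "b \<in> I [^]\<^bsub>ideals_set ?S\<^esub> Suc (sum m K)" for b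
      using mult_ideal_power_closed[OF S fin f I fractions_of_closed[OF S \<open>x \<in> fractions_of R S\<close>]
          m order_refl that] .
    then show ?colon by (intro exI[of _ "Suc (sum m K)"]) auto
  qed
  then show ?thesis using colon by blast
qed

end

section \<open>Invariance of quotients of invariants\<close>

text \<open>Regularity of the germ of \<open>f\<close> at \<open>x\<close>, with no domain attached.
  Sums and products then need no shrinking of open sets: the denominators are simply
  multiplied.\<close>

definition rational_at :: "nat \<Rightarrow> (nat \<Rightarrow> 'k::field) set \<Rightarrow> (nat \<Rightarrow> 'k) \<Rightarrow> ((nat \<Rightarrow> 'k) \<Rightarrow> 'k) \<Rightarrow> bool" where
  "rational_at n V x f \<longleftrightarrow> (\<exists>p\<in>poly_funs n. \<exists>q\<in>poly_funs n. q x \<noteq> 0 \<and>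
    (\<forall>y\<in>V. q y \<noteq> 0 \<longrightarrow> f y = p y / q y))"

lemma rational_atE:
  assumes "rational_at n V x f"
  obtains p q where "p \<in> poly_funs n" "q \<in> poly_funs n" "q x \<noteq> 0"
    "\<And>y. y \<in> V \<Longrightarrow> q y \<noteq> 0 \<Longrightarrow> f y = p y / q y"
  using assms unfolding rational_at_def by blast

lemma rational_atI:
  assumes "p \<in> poly_funs n" "q \<in> poly_funs n" "q x \<noteq> 0"
    "\<And>y. y \<in> V \<Longrightarrow> q y \<noteq> 0 \<Longrightarrow> f y = p y / q y"
  shows "rational_at n V x f"
  using assms unfolding rational_at_def by blast

lemma rational_at_poly:
  assumes "p \<in> poly_funs n" "\<And>y. y \<in> V \<Longrightarrow> f y = p y"
  shows "rational_at n V x f"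
  unfolding rational_at_def
  using assms by (intro bexI[of _ p] bexI[of _ "\<lambda>x. 1"]) (auto intro: poly_funs.const)

lemma rational_at_const: "rational_at n V x (\<lambda>y. c)"
  by (rule rational_at_poly[OF poly_funs.const]) simp

lemma rational_at_add:
  assumes "rational_at n V x f" "rational_at n V x g"
  shows "rational_at n V x (\<lambda>y. f y + g y)"
proof -
  obtain p q where f: "p \<in> poly_funs n" "q \<in> poly_funs n" "q x \<noteq> 0"
    "\<And>y. y \<in> V \<Longrightarrow> q y \<noteq> 0 \<Longrightarrow> f y = p y / q y"
    using assms(1) by (rule rational_atE) blast
  obtain p' q' where g: "p' \<in> poly_funs n" "q' \<in> poly_funs n" "q' x \<noteq> 0"
    "\<And>y. y \<in> V \<Longrightarrow> q' y \<noteq> 0 \<Longrightarrow> g y = p' y / q' y"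
    using assms(2) by (rule rational_atE) blast
  have "(\<lambda>y. p y * q' y + p' y * q y) \<in> poly_funs n" "(\<lambda>y. q y * q' y) \<in> poly_funs n"
    using f g by (auto intro: poly_funs.intros)
  then show ?thesis
    by (rule rational_atI) (use f g in \<open>auto simp: add_frac_eq\<close>)
qed

lemma rational_at_mult:
  assumes "rational_at n V x f" "rational_at n V x g"
  shows "rational_at n V x (\<lambda>y. f y * g y)"
proof -
  obtain p q where f: "p \<in> poly_funs n" "q \<in> poly_funs n" "q x \<noteq> 0"
    "\<And>y. y \<in> V \<Longrightarrow> q y \<noteq> 0 \<Longrightarrow> f y = p y / q y"
    using assms(1) by (rule rational_atE) blast
  obtain p' q' where g: "p' \<in> poly_funs n" "q' \<in> poly_funs n" "q' x \<noteq> 0"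
    "\<And>y. y \<in> V \<Longrightarrow> q' y \<noteq> 0 \<Longrightarrow> g y = p' y / q' y"
    using assms(2) by (rule rational_atE) blast
  have "(\<lambda>y. p y * p' y) \<in> poly_funs n" "(\<lambda>y. q y * q' y) \<in> poly_funs n"
    using f g by (auto intro: poly_funs.intros)
  then show ?thesis
    by (rule rational_atI) (use f g in auto)
qed

lemma rational_at_sum:
  "(\<And>i. i < m \<Longrightarrow> rational_at n V x (f i)) \<Longrightarrow> rational_at n V x (\<lambda>y. \<Sum>i<m. f i y)" for m :: nat
  by (induction m) (auto intro: rational_at_const rational_at_add)

lemma rational_at_reg:
  "f \<in> reg (affine_variety n V) U \<Longrightarrow> x \<in> U \<Longrightarrow> rational_at n V x f"
  unfolding affine_variety_def rational_at_def by fastforce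

lemma restrict_poly_reg:
  assumes "p \<in> poly_funs n"
  shows "restrict p V \<in> reg (affine_variety n V) V"
proof -
  have "\<forall>x\<in>V. \<exists>p'\<in>poly_funs n. \<exists>q\<in>poly_funs n. q x \<noteq> 0 \<and>
      (\<forall>y\<in>V. q y \<noteq> 0 \<longrightarrow> y \<in> V \<and> restrict p V y = p' y / q y)"
    by (intro ballI bexI[OF _ assms] bexI[OF _ poly_funs.const[of 1]]) simp
  then show ?thesis by (simp add: affine_variety_def)
qed

section \<open>The Zariski topology of an affine variety\<close>

lemma openin_affine_basic:
  "p \<in> poly_funs n \<Longrightarrow> openin (topo (affine_variety n V)) {x \<in> V. p x \<noteq> 0}"
  unfolding affine_variety_def by (auto intro: topology_generated_by_Basis)

lemma topspace_affine:
  "topspace (topo (affine_variety n V)) = (V :: (nat \<Rightarrow> 'a::field) set)"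
proof -
  have "V = {x \<in> V. (\<lambda>x. 1) x \<noteq> (0 :: 'a)}" by simp
  then have "V \<subseteq> \<Union>{{x \<in> V. p x \<noteq> 0} |p. p \<in> (poly_funs n :: ((nat \<Rightarrow> 'a) \<Rightarrow> 'a) set)}"
    using poly_funs.const by blast
  then show ?thesis
    unfolding affine_variety_def by auto
qed

text \<open>Multiplying polynomials intersects the generating sets, so these are a basis and not
  only a subbasis.\<close>

lemma openin_affine_nhd:
  assumes "openin (topo (affine_variety n V)) U" "x \<in> U"
  obtains q where "q \<in> poly_funs n" "q x \<noteq> 0" "{y \<in> V. q y \<noteq> 0} \<subseteq> U"
proof -
  have "generate_topology_on {{x \<in> V. p x \<noteq> 0} |p. p \<in> poly_funs n} U"
    using assms(1) by (simp add: affine_variety_def openin_topology_generated_by_iff)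
  then have "\<exists>q\<in>poly_funs n. q x \<noteq> 0 \<and> {y \<in> V. q y \<noteq> 0} \<subseteq> U"
    using assms(2)
  proof (induction rule: generate_topology_on.induct)
    case (Int U W)
    then obtain p q where "p \<in> poly_funs n" "p x \<noteq> 0" "{y \<in> V. p y \<noteq> 0} \<subseteq> U"
      and "q \<in> poly_funs n" "q x \<noteq> 0" "{y \<in> V. q y \<noteq> 0} \<subseteq> W" by blast
    then show ?case by (intro bexI[of _ "\<lambda>y. p y * q y"]) (auto intro: poly_funs.mult)
  next
    case (UN K)
    then show ?case by blast
  qed auto
  then show thesis using that by blast
qed

text \<open>Otherwise the complements would be two proper closed sets covering the space.\<close>

lemma irreducible_open_Int:
  assumes "irreducible_space T" "openin T U" "openin T W" "U \<noteq> {}" "W \<noteq> {}"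
  shows "U \<inter> W \<noteq> {}"
proof
  assume "U \<inter> W = {}"
  then have "topspace T = (topspace T - U) \<union> (topspace T - W)" by blast
  then have "topspace T = topspace T - U \<or> topspace T = topspace T - W"
    using assms(1-3) unfolding irreducible_space_def by blast
  then show False using assms(2-5) openin_subset by blast
qed

section \<open>Translates of regular functions under the action\<close>

lemma prod_space_regD:
  assumes "f \<in> reg (prod_space M N) D" "z \<in> D"
  shows "\<exists>U W s t. openin (topo M) U \<and> openin (topo N) W \<and>
    s \<in> tensor_funs M N U W \<and> t \<in> tensor_funs M N U W \<and>
    z \<in> U \<times> W \<and> t z \<noteq> 0 \<and> (\<forall>w\<in>U \<times> W. t w \<noteq> 0 \<longrightarrow> w \<in> D \<and> f w = s w / t w)"
proof -
  have "\<forall>z\<in>D. \<exists>U W s t. openin (topo M) U \<and> openin (topo N) W \<and>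
    s \<in> tensor_funs M N U W \<and> t \<in> tensor_funs M N U W \<and>
    z \<in> U \<times> W \<and> t z \<noteq> 0 \<and> (\<forall>w\<in>U \<times> W. t w \<noteq> 0 \<longrightarrow> w \<in> D \<and> f w = s w / t w)"
    using assms(1) unfolding prod_space_def by (simp only: fun_space.simps mem_Collect_eq) blast
  then show ?thesis using assms(2) by (rule bspec)
qed

text \<open>Composed with the action, \<open>h\<close> is regular on the product with the group, so
  near \<open>(g, x)\<close> it is a quotient of finite sums of \<open>a i g * b i y\<close>. With
  \<open>g\<close> fixed the factors \<open>a i g\<close> are constants and the sums become rational
  in \<open>y\<close>.\<close>

lemma action_reg_fraction:
  assumes group: "algebraic_group G M"
    and action: "algebraic_action G M (affine_variety n (V :: (nat \<Rightarrow> 'b::field) set)) \<phi>"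
    and g: "g \<in> carrier G" and x: "x \<in> V" and h: "h \<in> reg (affine_variety n V) V"
  obtains W s t where "openin (topo (affine_variety n V)) W" "x \<in> W"
    "rational_at n V x s" "rational_at n V x t" "t x \<noteq> 0"
    "\<And>y. y \<in> W \<Longrightarrow> t y \<noteq> 0 \<Longrightarrow> h (\<phi> g y) = s y / t y"
proof -
  let ?N = "affine_variety n V"
  interpret group_action G V \<phi>
    using action by (simp add: algebraic_action_def topspace_affine)
  have swf: "space_with_functions M" and top: "topspace (topo M) = carrier G"
    using group by (auto simp: algebraic_group_def variety_def)
  define D where "D = {z \<in> topspace (topo (prod_space M ?N)). (\<lambda>(g, v). \<phi> g v) z \<in> V}"
  have "openin (topo ?N) V" using openin_topspace[of "topo ?N"] by (simp add: topspace_affine)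
  then have reg: "(\<lambda>z\<in>D. h ((\<lambda>(g, v). \<phi> g v) z)) \<in> reg (prod_space M ?N) D"
    using action h unfolding algebraic_action_def morphism_def D_def by blast
  have one_M: "(\<lambda>x\<in>carrier G. 1) \<in> reg M (carrier G)"
    using swf openin_topspace[of "topo M"] unfolding space_with_functions_def top by blast
  have one_N: "(\<lambda>x\<in>V. 1) \<in> reg ?N V"
    by (intro restrict_poly_reg poly_funs.const)
  \<comment> \<open>The constant one as a tensor function: its nonvanishing set is a basic open set
    containing \<open>(g, x)\<close>, so this point belongs to the product space.\<close>
  define one where "one = (\<lambda>(x, y). \<Sum>i<Suc 0. (\<lambda>x\<in>carrier G. 1::'b) x * (\<lambda>x\<in>V. 1) y)"
  have "one \<in> tensor_funs M ?N (carrier G) V"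
    unfolding tensor_funs_def one_def
    by (intro CollectI exI[of _ "Suc 0"] exI[of _ "\<lambda>i. \<lambda>x\<in>carrier G. 1"]
        exI[of _ "\<lambda>i. \<lambda>x\<in>V. 1"]) (use one_M one_N in auto)
  moreover have "openin (topo M) (carrier G)" using openin_topspace[of "topo M"] by (simp add: top)
  moreover have "one (g, x) \<noteq> 0" using g x by (simp add: one_def)
  ultimately have "(g, x) \<in> topspace (topo (prod_space M ?N))"
    unfolding prod_space_def using \<open>openin (topo ?N) V\<close> g x
    by (auto intro!: exI[of _ "{z \<in> carrier G \<times> V. one z \<noteq> 0}"])
  then have gx: "(g, x) \<in> D" using element_image[OF g x] by (simp add: D_def)
  then obtain U W s t where W: "openin (topo ?N) W"
    and st: "s \<in> tensor_funs M ?N U W" "t \<in> tensor_funs M ?N U W"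
    and mem: "(g, x) \<in> U \<times> W" and nz: "t (g, x) \<noteq> 0"
    and eq: "\<forall>w\<in>U \<times> W. t w \<noteq> 0 \<longrightarrow> w \<in> D \<and> (\<lambda>z\<in>D. h ((\<lambda>(g, v). \<phi> g v) z)) w = s w / t w"
    using prod_space_regD[OF reg gx] by metis
  have rational: "rational_at n V x (\<lambda>y. s (g, y))" if s: "s \<in> tensor_funs M ?N U W" for s
  proof -
    obtain m :: nat and a b where "s = (\<lambda>(x, y). \<Sum>i<m. a i x * b i y)"
      and b: "\<And>i. i < m \<Longrightarrow> b i \<in> reg ?N W"
      using s unfolding tensor_funs_def by blast
    then have "(\<lambda>y. s (g, y)) = (\<lambda>y. \<Sum>i<m. a i g * b i y)" by simp
    moreover have "rational_at n V x (\<lambda>y. \<Sum>i<m. a i g * b i y)"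
      using mem by (intro rational_at_sum rational_at_mult rational_at_const rational_at_reg[OF b]) auto
    ultimately show ?thesis by simp
  qed
  have "h (\<phi> g y) = s (g, y) / t (g, y)" if "y \<in> W" "t (g, y) \<noteq> 0" for y
    using eq[THEN bspec, of "(g, y)"] mem that by auto
  then show thesis
    using that[of W "\<lambda>y. s (g, y)" "\<lambda>y. t (g, y)"] W mem nz rational st by blast
qed

text \<open>Near a point of the set, the translate of \<open>h\<close> is \<open>s / t\<close> with
  \<open>s\<close> and \<open>t\<close> rational there. Nonvanishing of \<open>t (s - h t)\<close>
  says both that \<open>t\<close> is nonzero and that \<open>s / t\<close> differs from
  \<open>h\<close>, and it is an open condition.\<close>

lemma openin_not_fixed:
  assumes group: "algebraic_group G M"
    and action: "algebraic_action G M (affine_variety n V) \<phi>"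
    and g: "g \<in> carrier G" and h: "h \<in> carrier (coordinate_ring n V)"
  shows "openin (topo (affine_variety n V)) {x \<in> V. h (\<phi> g x) \<noteq> h x}" (is "openin _ ?E")
proof (subst openin_subopen, intro ballI)
  fix x assume "x \<in> ?E"
  then have x: "x \<in> V" "h (\<phi> g x) \<noteq> h x" by auto
  obtain p where p: "p \<in> poly_funs n" "h = restrict p V"
    using h by (auto simp: coordinate_ring_def)
  have "h \<in> reg (affine_variety n V) V"
    using p by (simp add: restrict_poly_reg)
  then obtain W s t where W: "openin (topo (affine_variety n V)) W" "x \<in> W"
    and st: "rational_at n V x s" "rational_at n V x t" "t x \<noteq> 0"
    and eq: "\<And>y. y \<in> W \<Longrightarrow> t y \<noteq> 0 \<Longrightarrow> h (\<phi> g y) = s y / t y"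
    using action_reg_fraction[OF group action g x(1)] by blast
  have "rational_at n V x h" by (rule rational_at_poly[OF p(1)]) (simp add: p(2))
  then have "rational_at n V x (\<lambda>y. t y * (s y + (-1) * (h y * t y)))"
    using st by (intro rational_at_mult rational_at_add rational_at_const)
  then obtain a b where ab: "a \<in> poly_funs n" "b \<in> poly_funs n" "b x \<noteq> 0"
    "\<And>y. y \<in> V \<Longrightarrow> b y \<noteq> 0 \<Longrightarrow> t y * (s y + (-1) * (h y * t y)) = a y / b y"
    by (rule rational_atE) blast
  obtain q where q: "q \<in> poly_funs n" "q x \<noteq> 0" "{y \<in> V. q y \<noteq> 0} \<subseteq> W"
    using W by (rule openin_affine_nhd)
  have "a x \<noteq> 0" using ab(4)[OF x(1) ab(3)] eq[OF W(2) st(3)] st(3) x(2) by (auto simp: field_simps)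
  \<comment> \<open>The factor \<open>q\<close> confines the set to \<open>W\<close>;
    \<open>b\<close> makes the representation \<open>a / b\<close> valid and \<open>a\<close> keeps
    its value nonzero.\<close>
  let ?T = "{y \<in> V. q y * (a y * b y) \<noteq> 0}"
  have "openin (topo (affine_variety n V)) ?T"
    by (intro openin_affine_basic poly_funs.mult q ab)
  moreover have "x \<in> ?T" using x(1) q(2) ab(3) \<open>a x \<noteq> 0\<close> by simp
  moreover have "?T \<subseteq> ?E"
  proof
    fix y assume y: "y \<in> ?T"
    then have "t y * (s y + (-1) * (h y * t y)) \<noteq> 0" using ab(4)[of y] by auto
    then have "t y \<noteq> 0" "s y / t y \<noteq> h y" by (auto simp: field_simps)
    then show "y \<in> ?E" using eq[of y] y q(3) by auto
  qed
  ultimately show "\<exists>T. openin (topo (affine_variety n V)) T \<and> x \<in> T \<and> T \<subseteq> ?E" by blast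
qed

lemma coordinate_ring_mult_apply: "x \<in> V \<Longrightarrow> (a \<otimes>\<^bsub>coordinate_ring n V\<^esub> b) x = a x * b x"
  by (simp add: coordinate_ring_def)

lemma coordinate_ring_pow_apply:
  "x \<in> V \<Longrightarrow> (a [^]\<^bsub>coordinate_ring n V\<^esub> (m::nat)) x = a x ^ m"
proof (induction m)
  case 0
  then show ?case by (simp add: coordinate_ring_def nat_pow_def)
next
  case (Suc m)
  have "a [^]\<^bsub>coordinate_ring n V\<^esub> Suc m
      = a [^]\<^bsub>coordinate_ring n V\<^esub> m \<otimes>\<^bsub>coordinate_ring n V\<^esub> a"
    by (simp add: nat_pow_def)
  then show ?case using Suc by (simp add: coordinate_ring_mult_apply)
qed

lemma invariant_of_fraction:
  assumes group: "algebraic_group G M"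
    and action: "algebraic_action G M (affine_variety n V) \<phi>"
    and irreducible: "irreducible_space (topo (affine_variety n V))"
    and R: "R = coordinate_ring n V"
    and h: "h \<in> carrier R"
    and a: "a \<in> invariant_ring G \<phi> V R" and b: "b \<in> invariant_ring G \<phi> V R"
    and nz: "b \<noteq> \<zero>\<^bsub>R\<^esub>" and eq: "h \<otimes>\<^bsub>R\<^esub> b = a"
  shows "h \<in> invariant_ring G \<phi> V R"
proof -
  interpret group_action G V \<phi>
    using action by (simp add: algebraic_action_def topspace_affine)
  interpret group G using group by (simp add: algebraic_group_def)
  have ext: "c \<in> extensional V" if "c \<in> carrier R" for c
    using that by (auto simp: R coordinate_ring_def)
  have bR: "b \<in> carrier R" using b by (simp add: invariant_ring_def)
  have fixed: "h (\<phi> (inv\<^bsub>G\<^esub> g) x) = h x" if g: "g \<in> carrier G" and x: "x \<in> V" for g x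
  proof (rule ccontr)
    assume contr: "h (\<phi> (inv\<^bsub>G\<^esub> g) x) \<noteq> h x"
    have g': "inv\<^bsub>G\<^esub> g \<in> carrier G" using g by simp
    let ?E = "{x \<in> V. h (\<phi> (inv\<^bsub>G\<^esub> g) x) \<noteq> h x}"
    have "openin (topo (affine_variety n V)) ?E"
      using openin_not_fixed[OF group action g'] h R by blast
    moreover have "?E \<noteq> {}" using x contr by blast
    moreover obtain p where p: "p \<in> poly_funs n" "b = restrict p V"
      using bR by (auto simp: R coordinate_ring_def)
    then have "openin (topo (affine_variety n V)) {x \<in> V. p x \<noteq> 0}"
      by (intro openin_affine_basic)
    moreover have "{x \<in> V. p x \<noteq> 0} \<noteq> {}"
    proof
      assume "{x \<in> V. p x \<noteq> 0} = {}"
      then have "b = \<zero>\<^bsub>R\<^esub>" using p(2) by (auto simp: R coordinate_ring_def restrict_def)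
      then show False using nz by blast
    qed
    \<comment> \<open>Two nonempty open sets of an irreducible space meet, here in a point where
      \<open>h\<close> is moved and \<open>b\<close> is nonzero.\<close>
    ultimately obtain y where y: "y \<in> V" "h (\<phi> (inv\<^bsub>G\<^esub> g) y) \<noteq> h y" "p y \<noteq> 0"
      using irreducible_open_Int[OF irreducible, of ?E "{x \<in> V. p x \<noteq> 0}"] by blast
    have inv: "c (\<phi> (inv\<^bsub>G\<^esub> g) y) = c y" if "c \<in> invariant_ring G \<phi> V R" for c
    proof -
      have "(\<lambda>x\<in>V. c (\<phi> (inv\<^bsub>G\<^esub> g) x)) y = c y" using that g by (simp add: invariant_ring_def)
      then show ?thesis using y(1) by simp
    qed
    have point: "h z * b z = a z" if "z \<in> V" for z
      using eq coordinate_ring_mult_apply[OF that] R by metis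
    \<comment> \<open>The relation \<open>h b = a\<close> is compared at \<open>y\<close> and at its
      translate, where \<open>a\<close> and \<open>b\<close> take the same values; then
      \<open>b y\<close> cancels.\<close>
    have "h (\<phi> (inv\<^bsub>G\<^esub> g) y) * b y = h y * b y"
      using point[OF element_image[OF g' y(1) refl]] point[OF y(1)] inv[OF a] inv[OF b] by simp
    then show False using y p(2) by simp
  qed
  have "(\<lambda>x\<in>V. h (\<phi> (inv\<^bsub>G\<^esub> g) x)) = h" if "g \<in> carrier G" for g
    using fixed[OF that] ext[OF h] by (intro extensionalityI[of _ V]) auto
  then show ?thesis using h by (simp add: invariant_ring_def)
qed

section \<open>Separating algebras and rings of invariants\<close>

theorem theorem2p1:
  fixes G :: "('g, 'b) monoid_scheme"
    and M :: "('g, 'k::alg_closed_field) fun_space"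
    and n r :: nat
    and V :: "(nat \<Rightarrow> 'k) set"
    and \<phi> :: "'g \<Rightarrow> (nat \<Rightarrow> 'k) \<Rightarrow> (nat \<Rightarrow> 'k)"
    and R :: "((nat \<Rightarrow> 'k) \<Rightarrow> 'k) ring"
    and B A :: "((nat \<Rightarrow> 'k) \<Rightarrow> 'k) set"
    and L :: "(((nat \<Rightarrow> 'k) \<Rightarrow> 'k) \<times> ((nat \<Rightarrow> 'k) \<Rightarrow> 'k)) set ring"
    and \<iota> :: "((nat \<Rightarrow> 'k) \<Rightarrow> 'k) \<Rightarrow> (((nat \<Rightarrow> 'k) \<Rightarrow> 'k) \<times> ((nat \<Rightarrow> 'k) \<Rightarrow> 'k)) set"
    and I :: "(((nat \<Rightarrow> 'k) \<Rightarrow> 'k) \<times> ((nat \<Rightarrow> 'k) \<Rightarrow> 'k)) set set"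
    and f :: "nat \<Rightarrow> (nat \<Rightarrow> 'k) \<Rightarrow> 'k"
  assumes group: "algebraic_group G M"
    and closed: "zariski_closed n V"
    and irreducible: "irreducible_space (topo (affine_variety n V))"
    and R_eq: "R = coordinate_ring n V"
    and normal: "normal_domain R"
    and action: "algebraic_action G M (affine_variety n V) \<phi>"
    and B_eq: "B = invariant_ring G \<phi> V R"
    and A_subalgebra: "k_subalgebra V R A"
    and A_fin_gen: "finitely_generated_over_k V R A"
    and A_invariant: "A \<subseteq> B"
    and f_in: "\<forall>i\<in>{1..r}. f i \<in> A"
    and L_eq: "L = frac_field R"
    and \<iota>_eq: "\<iota> = frac_embed R"
    and local_eq: "\<forall>i\<in>{1..r}. localize_at L (\<iota> ` A) (\<iota> (f i)) = localize_at L (\<iota> ` B) (\<iota> (f i))"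
    and I_eq: "I = genideal (L\<lparr>carrier := \<iota> ` A\<rparr>) (\<iota> ` f ` {1..r})"
  shows "(ideal_height R (genideal R (f ` {1..r})) \<ge> 2 \<longrightarrow>
            \<iota> ` B = regular_on_complement L (\<iota> ` A) I \<and>
            \<iota> ` B = colon_inf (L\<lparr>carrier := fractions_of L (\<iota> ` A)\<rparr>) (\<iota> ` A) I) \<and>
         (separating_algebra V R B A (zero_locus V (f ` {1..r})) \<longrightarrow>
            separating_algebra V R B A V)"
proof -
  interpret R: "domain" R using normal by (simp add: normal_domain_def)
  interpret L: field L unfolding L_eq by (rule R.frac_field_is_field)
  interpret E: embedded_domain R L \<iota>
    unfolding L_eq \<iota>_eq
    by (intro embedded_domain.intro embedded_domain_axioms.intro R.domain_axioms
        R.frac_field_is_field R.frac_embed_hom R.frac_embed_inj)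
  have noeth: "noetherian_seq R"
    unfolding R_eq using coordinate_ring_noetherian R.ring_axioms R_eq by blast
  have normal': "z \<in> \<iota> ` carrier R" if "z \<in> carrier L" "integral_over L (\<iota> ` carrier R) z" for z
    using normal that unfolding normal_domain_def L_eq \<iota>_eq by blast
  have A: "subring A R" using A_subalgebra by (simp add: k_subalgebra_def)
  have BR: "B \<subseteq> carrier R" unfolding B_eq invariant_ring_def by blast
  have AR: "A \<subseteq> carrier R" using A_invariant BR by blast
  have fA: "f i \<in> A" if "i \<in> {1..r}" for i using f_in that by blast
  have fR: "f ` {1..r} \<subseteq> carrier R" using fA AR by blast
  have S: "subring (\<iota> ` A) L" by (rule E.image_subring[OF A])
  \<comment> \<open>Used for both claims: equality of the localizations lets a power of each
    \<open>f i\<close> carry an invariant into \<open>A\<close>.\<close>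
  have frac: "\<exists>m::nat. \<iota> h \<otimes>\<^bsub>L\<^esub> \<iota> (f i) [^]\<^bsub>L\<^esub> m \<in> \<iota> ` A" if h: "h \<in> B" and i: "i \<in> {1..r}" for h i
  proof (rule L.localize_at_eqD[OF S])
    show "\<iota> ` B \<subseteq> carrier L" using BR E.hom_closed by blast
    show "localize_at L (\<iota> ` A) (\<iota> (f i)) = localize_at L (\<iota> ` B) (\<iota> (f i))"
      using local_eq i by blast
  qed (use h fA[OF i] in simp_all)
  show ?thesis
  proof (intro conjI impI)
    assume height: "2 \<le> ideal_height R (genideal R (f ` {1..r}))"
    interpret G: generated_subring_ideal L "\<iota> ` A" "{1..r}" "\<lambda>i. \<iota> (f i)" I
    proof (intro generated_subring_ideal.intro generated_subring_ideal_axioms.intro)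
      show "field L" by (rule L.field_axioms)
      show "subring (\<iota> ` A) L" by (rule S)
      show "(\<lambda>i. \<iota> (f i)) ` {1..r} \<subseteq> \<iota> ` A" using fA by blast
      show "I = genideal (L\<lparr>carrier := \<iota> ` A\<rparr>) ((\<lambda>i. \<iota> (f i)) ` {1..r})"
        by (simp only: I_eq image_image)
    qed simp
    \<comment> \<open>Writing an invariant as a fraction over \<open>A\<close> takes a nonzero
      denominator. If all \<open>f i\<close> vanished, or if there were none, they would generate
      the zero ideal, a prime with no prime below it, against the height.\<close>
    have nonzero: "\<exists>i\<in>{1..r}. f i \<noteq> \<zero>\<^bsub>R\<^esub>"
    proof (rule ccontr)
      assume "\<not> ?thesis"
      then have "genideal R (f ` {1..r}) \<subseteq> {\<zero>\<^bsub>R\<^esub>}"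
        by (intro R.genideal_minimal R.zeroideal) auto
      then obtain Q q where "Q \<subset> {\<zero>\<^bsub>R\<^esub>}" "q \<in> Q" "q \<noteq> \<zero>\<^bsub>R\<^esub>"
        using R.ideal_height_ge_2[OF height R.zeroprimeideal] by metis
      then show False by blast
    qed
    \<comment> \<open>To the condition on the right both rings are reduced by
      \<open>regular_on_complement_eq\<close> and \<open>colon_inf_eq\<close>.\<close>
    have eq: "\<iota> ` B = {x \<in> fractions_of L (\<iota> ` A).
      \<forall>i\<in>{1..r}. \<exists>m::nat. x \<otimes>\<^bsub>L\<^esub> \<iota> (f i) [^]\<^bsub>L\<^esub> m \<in> \<iota> ` A}" (is "_ = ?F")
    proof
      show "\<iota> ` B \<subseteq> ?F"
      proof (rule image_subsetI)
        fix h assume h: "h \<in> B"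
        obtain i where i: "i \<in> {1..r}" "f i \<noteq> \<zero>\<^bsub>R\<^esub>" using nonzero by blast
        obtain m :: nat where m: "\<iota> h \<otimes>\<^bsub>L\<^esub> \<iota> (f i) [^]\<^bsub>L\<^esub> m \<in> \<iota> ` A" using frac[OF h i(1)] by blast
        have fi: "\<iota> (f i) [^]\<^bsub>L\<^esub> m \<in> \<iota> ` A"
          using fA[OF i(1)] by (intro L.subring_power_closed[OF S]) blast
        have fiR: "f i \<in> carrier R" using fA[OF i(1)] AR by blast
        have nz: "\<iota> (f i) [^]\<^bsub>L\<^esub> m \<noteq> \<zero>\<^bsub>L\<^esub>"
          using i(2) fiR E.embed_eq_zero_iff by (induction m) (auto simp: L.integral_iff)
        have "\<iota> h = (\<iota> h \<otimes>\<^bsub>L\<^esub> \<iota> (f i) [^]\<^bsub>L\<^esub> m) \<otimes>\<^bsub>L\<^esub> inv\<^bsub>L\<^esub> (\<iota> (f i) [^]\<^bsub>L\<^esub> m)"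
          using h BR m fi nz subringE(1)[OF S]
            L.eq_divide_iff[of "\<iota> h" "\<iota> h \<otimes>\<^bsub>L\<^esub> \<iota> (f i) [^]\<^bsub>L\<^esub> m" "\<iota> (f i) [^]\<^bsub>L\<^esub> m"]
          by blast
        then have "\<iota> h \<in> fractions_of L (\<iota> ` A)" unfolding fractions_of_def using m fi nz by blast
        then show "\<iota> h \<in> ?F" using frac[OF h] by blast
      qed
      show "?F \<subseteq> \<iota> ` B"
      proof
        fix x assume x: "x \<in> ?F"
        then have xL: "x \<in> carrier L" using L.fractions_of_closed[OF S] by blast
        \<comment> \<open>Since \<open>A \<subseteq> carrier R\<close>, the powers that carry
          \<open>x\<close> into the image of \<open>A\<close> carry it into that of
          \<open>R\<close>, as the Hartogs theorem requires.\<close>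
        have "x \<in> \<iota> ` carrier R"
          using x AR by (intro E.normal_noetherian_hartogs[OF noeth normal' fR height xL]) blast+
        then obtain h where h: "h \<in> carrier R" "x = \<iota> h" by blast
        from x obtain a b where ab: "a \<in> A" "b \<in> A" "\<iota> b \<noteq> \<zero>\<^bsub>L\<^esub>" "x = \<iota> a \<otimes>\<^bsub>L\<^esub> inv\<^bsub>L\<^esub> \<iota> b"
          unfolding fractions_of_def by blast
        have abR: "a \<in> carrier R" "b \<in> carrier R" using ab AR by auto
        then have "\<iota> h \<otimes>\<^bsub>L\<^esub> \<iota> b = \<iota> a"
          using ab(3,4) h(2) xL L.eq_divide_iff[of x "\<iota> a" "\<iota> b"] E.hom_closed by metis
        then have "h \<otimes>\<^bsub>R\<^esub> b = a" 
          using h abR by (intro inj_onD[OF E.embed_inj]) auto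
        moreover have "b \<noteq> \<zero>\<^bsub>R\<^esub>" using ab(3) by auto
        ultimately have "h \<in> B"
          using invariant_of_fraction[OF group action irreducible R_eq h(1), of a b] ab(1,2) A_invariant
          unfolding B_eq by blast
        then show "x \<in> \<iota> ` B" using h(2) by blast
      qed
    qed
    show "\<iota> ` B = regular_on_complement L (\<iota> ` A) I"
      unfolding eq G.regular_on_complement_eq ..
    show "\<iota> ` B = colon_inf (L\<lparr>carrier := fractions_of L (\<iota> ` A)\<rparr>) (\<iota> ` A) I"
      unfolding eq G.colon_inf_eq ..
  next
    assume sep: "separating_algebra V R B A (zero_locus V (f ` {1..r}))"
    show "separating_algebra V R B A V"
      unfolding separating_algebra_def separating_set_def separates_def
    proof (intro conjI ballI impI A_subalgebra A_invariant)
      fix u v assume uv: "u \<in> V" "v \<in> V" and "\<exists>h\<in>B. h u \<noteq> h v"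
      then obtain h where h: "h \<in> B" "h u \<noteq> h v" by blast
      show "\<exists>a\<in>A. a u \<noteq> a v"
      proof (cases "\<exists>i\<in>{1..r}. f i u \<noteq> 0 \<or> f i v \<noteq> 0")
        case True
        then obtain i where i: "i \<in> {1..r}" "f i u \<noteq> 0 \<or> f i v \<noteq> 0" by blast
        show ?thesis
        \<comment> \<open>Either \<open>f i\<close> itself separates, or its common value at
          \<open>u\<close> and \<open>v\<close> is nonzero and the product \<open>a\<close> of
          \<open>h\<close> with a power of \<open>f i\<close> separates because \<open>h\<close>
          does.\<close>
        proof (cases "f i u = f i v")
          case True
          obtain m :: nat and a where a: "a \<in> A" "\<iota> h \<otimes>\<^bsub>L\<^esub> \<iota> (f i) [^]\<^bsub>L\<^esub> m = \<iota> a"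
            using frac[OF h(1) i(1)] by blast
          have c: "h \<in> carrier R" "f i \<in> carrier R" "a \<in> carrier R"
            using h BR fA[OF i(1)] AR a by auto
          then have "h \<otimes>\<^bsub>R\<^esub> f i [^]\<^bsub>R\<^esub> m = a"
            using a(2) by (intro inj_onD[OF E.embed_inj]) (simp_all add: E.embed_pow)
          then have "a u = h u * f i u ^ m" "a v = h v * f i v ^ m"
            using uv coordinate_ring_mult_apply coordinate_ring_pow_apply unfolding R_eq by metis+
          then have "a u \<noteq> a v" using True i(2) h(2) by auto
          then show ?thesis using a(1) by blast
        next
          case False
          then show ?thesis using fA[OF i(1)] by blast
        qed
      next
        case False
        then have "u \<in> zero_locus V (f ` {1..r})" "v \<in> zero_locus V (f ` {1..r})"
          using uv by (auto simp: zero_locus_def)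
        then show ?thesis
          using sep h unfolding separating_algebra_def separating_set_def separates_def by blast
      qed
    qed
  qed
qed

end
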